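(* Let $f:\mathbb{R}^d\to\mathbb{R}$ satisfy the Standing Assumptions with constants $0<\mu\le L$ and $M>0$, and let $\{x_t\}$ be generated by General Sharpened-BFGS from an initial point $x_0$ with $$\lambda_0\le\frac{C_1\mu}{dML},\qquad C_1=\frac{\ln2}{20},$$ assuming $\nabla f(x_t)\ne0$ for all $t$ considered. Then for all $t\ge1$, $$\lambda_t\le 2\left(1-\frac{\mu}{2dL}\right)^{\frac{t(t-1)}{4}}\left(\frac{8dL}{t\mu}\right)^{\frac t2}\lambda_0,$$ where $\lambda_t:=\lambda_f(x_t)$.
   Context: Standing Assumptions: $f$ is twice differentiable, $\mu$-strongly convex and has $L$-Lipschitz gradient, and is strongly self-concordant with constant $M>0$: for all $x,y,z,w\in\mathbb{R}^d$, $\nabla^2f(y)-\nabla^2f(x)\preceq M\|y-x\|_z\nabla^2f(w)$, where $\|h\|_z:=\sqrt{h^\top\nabla^2f(z)h}$. Newton decrement: $\lambda_f(x):=\sqrt{\nabla f(x)^\top\nabla^2f(x)^{-1}\nabla f(x)}$. For symmetric positive definite $A,G$ and $u\ne0$, $\mathrm{BFGS}(A,G,u):=G-\frac{Guu^\top G}{u^\top Gu}+\frac{Auu^\top A}{u^\top Au}$, and $\bar u(A,G):=\arg\max_{u\in\{e_1,\dots,e_d\}}\frac{u^\top Gu}{u^\top Au}$ (ties broken arbitrarily). General Sharpened-BFGS: set $G_0=LI$; for $t=0,1,2,\dots$: $x_{t+1}=x_t-G_t^{-1}\nabla f(x_t)$; $s_t=x_{t+1}-x_t$; $J_t=\int_0^1\nabla^2f(x_t+\tau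 s_t)\,d\tau$; $\bar G_t=\mathrm{BFGS}(J_t,G_t,s_t)$; $r_t=\|s_t\|_{x_t}$; $\hat G_t=(1+Mr_t/2)^2\bar G_t$; $\bar u=\bar u(\nabla^2f(x_{t+1}),\hat G_t)$; $G_{t+1}=\mathrm{BFGS}(\nabla^2f(x_{t+1}),\hat G_t,\bar u)$. *)

theory Defs
  imports "HOL-Analysis.Analysis"
begin

definition outer :: "real^'n \<Rightarrow> real^'n \<Rightarrow> real^'n^'n" where
  "outer u v = (\<chi> i j. u$i * v$j)"

definition qform :: "real^'n^'n \<Rightarrow> real^'n \<Rightarrow> real" where
  "qform A u = u \<bullet> (A *v u)"

definition BFGS :: "real^'n^'n \<Rightarrow> real^'n^'n \<Rightarrow> real^'n \<Rightarrow> real^'n^'n" where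
  "BFGS A G u = G - (1 / qform G u) *\<^sub>R outer (G *v u) (vector_matrix_mult u G)
                  + (1 / qform A u) *\<^sub>R outer (A *v u) (vector_matrix_mult u A)"

definition loewner_le :: "real^'n^'n \<Rightarrow> real^'n^'n \<Rightarrow> bool" where
  "loewner_le A B \<longleftrightarrow> (\<forall>v. qform A v \<le> qform B v)"

definition local_norm :: "(real^'n \<Rightarrow> real^'n^'n) \<Rightarrow> real^'n \<Rightarrow> real^'n \<Rightarrow> real" where
  "local_norm H z h = sqrt (qform (H z) h)"

definition newton_decrement ::
  "(real^'n \<Rightarrow> real^'n) \<Rightarrow> (real^'n \<Rightarrow> real^'n^'n) \<Rightarrow> real^'n \<Rightarrow> real" where
  "newton_decrement g H x = sqrt (g x \<bullet> (matrix_inv (H x) *v g x))"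

definition strongly_convex_on :: "'a::real_normed_vector set \<Rightarrow> real \<Rightarrow> ('a \<Rightarrow> real) \<Rightarrow> bool" where
  "strongly_convex_on S mu f \<longleftrightarrow> convex_on S (\<lambda>x. f x - mu / 2 * (norm x)\<^sup>2)"

definition strongly_self_concordant :: "real \<Rightarrow> (real^'n \<Rightarrow> real^'n^'n) \<Rightarrow> bool" where
  "strongly_self_concordant M H \<longleftrightarrow>
     (\<forall>x y z w. loewner_le (H y - H x) ((M * local_norm H z (y - x)) *\<^sub>R H w))"

definition greedy_ratio :: "real^'n^'n \<Rightarrow> real^'n^'n \<Rightarrow> 'n \<Rightarrow> real" where
  "greedy_ratio A G i = qform G (axis i 1) / qform A (axis i 1)"

end

theory Submission
  imports Defs
begin

text \<open>Write \<open>\<sigma>\<^sub>k = tr (H(x\<^sub>k)\<^sup>-\<^sup>1 G\<^sub>k) - d\<close> and \<open>\<rho> = \<mu> / (d L)\<close>. The correction factor \<open>\<kappa> = 1 + M r / 2\<close> keeps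
  \<open>H(x\<^sub>k) \<preceq> G\<^sub>k \<preceq> \<eta>\<^sub>k H(x\<^sub>k)\<close>, where \<open>\<eta>\<^sub>k\<close> grows by a factor \<open>\<kappa>\<^sup>4\<close> per step. As long as
  \<open>\<eta>\<^sub>k \<le> (15/13) L / \<mu>\<close> the Newton decrement contracts by \<open>1 - 3\<mu> / (4L)\<close>, and this decay in turn makes
  the product of the factors \<open>\<kappa>\<^sup>4\<close> at most \<open>15/13\<close>.

  The BFGS update along the step lowers the trace by about \<open>\<theta>\<^sub>k\<^sup>2\<close>, where \<open>\<lambda>\<^sub>k\<^sub>+\<^sub>1 \<le> \<phi>\<^sub>k\<^sup>1\<^sup>/\<^sup>2 \<lambda>\<^sub>k\<close> with
  \<open>\<phi>\<^sub>k = \<kappa> \<theta>\<^sub>k\<^sup>2\<close>, and the greedy update contracts \<open>\<sigma>\<close> by \<open>1 - \<rho>\<close>. Together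
  \<open>\<sigma>\<^sub>k\<^sub>+\<^sub>1 \<le> (1 - \<rho>) (\<sigma>\<^sub>k + 4 M \<lambda>\<^sub>k d L / \<mu> - \<phi>\<^sub>k)\<close>. Dividing by \<open>q\<^sup>k\<close> with \<open>q = 1 - \<rho> / 2\<close>, which decays
  more slowly than \<open>\<lambda>\<^sub>k\<close>, gives a bound on \<open>\<Sum> \<phi>\<^sub>k / q\<^sup>k\<close>; AM--GM turns it into a bound on \<open>\<Prod> \<phi>\<^sub>k\<close>.\<close>

section \<open>Positive definite matrices and the BFGS update\<close>

definition posdef :: "real^'n^'n \<Rightarrow> bool" where
  "posdef A \<longleftrightarrow> transpose A = A \<and> (\<forall>v. v \<noteq> 0 \<longrightarrow> 0 < qform A v)"

section \<open>Quadratic forms, rank-one matrices and traces\<close>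

lemma symmetric_vector_matrix:
  fixes A :: "real^'n^'n"
  assumes "transpose A = A"
  shows "u v* A = A *v u"
  by (metis assms transpose_matrix_vector)

lemma symmetric_inner:
  fixes A :: "real^'n^'n"
  assumes "transpose A = A"
  shows "(A *v u) \<bullet> w = u \<bullet> (A *v w)"
  by (metis assms symmetric_vector_matrix dot_lmul_matrix)

lemma symmetric_inner_commute:
  fixes A :: "real^'n^'n"
  assumes "transpose A = A"
  shows "u \<bullet> (A *v w) = w \<bullet> (A *v u)"
  by (metis assms symmetric_inner inner_commute)

lemma transpose_add: "transpose (A + B) = transpose A + transpose (B::real^'n^'m)"
  by (simp add: transpose_def vec_eq_iff)

lemma transpose_diff: "transpose (A - B) = transpose A - transpose (B::real^'n^'m)"
  by (simp add: transpose_def vec_eq_iff)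

lemma scaleR_matrix_vector: "(c *\<^sub>R A) *v v = c *\<^sub>R (A *v (v::real^'n))" for A :: "real^'n^'m"
  by (simp add: scaleR_matrix_vector_assoc)

lemma qform_scaleR [simp]: "qform (c *\<^sub>R A) v = c * qform A v"
  by (simp add: qform_def scaleR_matrix_vector)

lemma qform_add [simp]: "qform (A + B) v = qform A v + qform B v"
  by (simp add: qform_def matrix_vector_mult_add_rdistrib inner_add_right)

lemma qform_diff [simp]: "qform (A - B) v = qform A v - qform B v"
  by (simp add: qform_def matrix_vector_mult_diff_rdistrib inner_diff_right)

lemma qform_scale_arg: "qform A (c *\<^sub>R v) = c\<^sup>2 * qform A v"
  by (simp add: qform_def matrix_vector_mult_scaleR power2_eq_square)

lemma qform_mat_1 [simp]: "qform (mat 1) v = v \<bullet> v"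
  by (simp add: qform_def)

lemma qform_0 [simp]: "qform A 0 = 0"
  by (simp add: qform_def)

lemma qform_add_scaled:
  assumes "transpose A = A"
  shows "qform A (v + c *\<^sub>R u) = qform A v + 2 * c * (u \<bullet> (A *v v)) + c\<^sup>2 * qform A u"
  using symmetric_inner_commute[OF assms, of u v]
  by (simp add: qform_def matrix_vector_right_distrib matrix_vector_mult_scaleR inner_add_left
      inner_add_right power2_eq_square algebra_simps)

lemma qform_diff_scaled:
  assumes "transpose A = A"
  shows "qform A (v - c *\<^sub>R u) = qform A v - 2 * c * (u \<bullet> (A *v v)) + c\<^sup>2 * qform A u"
  using qform_add_scaled[OF assms, of v "-c" u] by simp

lemma posdef_nonneg: "posdef A \<Longrightarrow> 0 \<le> qform A v"
  by (cases "v = 0") (auto simp: posdef_def intro: less_imp_le)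

lemma posdef_pos: "posdef A \<Longrightarrow> v \<noteq> 0 \<Longrightarrow> 0 < qform A v"
  by (auto simp: posdef_def)

lemma posdef_sym: "posdef A \<Longrightarrow> transpose A = A"
  by (auto simp: posdef_def)

lemma posdef_scaleR: "posdef A \<Longrightarrow> 0 < c \<Longrightarrow> posdef (c *\<^sub>R A)"
  by (simp add: posdef_def transpose_scalar)

lemma posdef_mat_1: "posdef (mat 1)"
  by (simp add: posdef_def)

lemma outer_mult: "outer a b *v w = (b \<bullet> w) *\<^sub>R a"
  by (simp add: outer_def vec_eq_iff matrix_vector_mult_def inner_vec_def sum_distrib_left
      sum_distrib_right algebra_simps)

lemma qform_outer: "qform (outer a b) w = (a \<bullet> w) * (b \<bullet> w)"
  by (simp add: qform_def outer_mult inner_commute)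

lemma transpose_outer: "transpose (outer a b) = outer b a"
  by (simp add: outer_def transpose_def vec_eq_iff)

lemma trace_mult_outer: "trace (P ** outer a b) = b \<bullet> (P *v a)"
  by (simp add: trace_def outer_def matrix_matrix_mult_def matrix_vector_mult_def inner_vec_def
      sum_distrib_left algebra_simps)

lemma trace_mult_add: "trace (P ** (A + B)) = trace (P ** A) + trace (P ** (B::real^'n^'n))"
  by (simp add: matrix_add_ldistrib trace_add)

lemma trace_mult_scaleR: "trace (P ** (c *\<^sub>R A)) = c * trace (P ** (A::real^'n^'n))"
  by (simp add: trace_def matrix_matrix_mult_def sum_distrib_left algebra_simps)

lemma trace_mult_diff: "trace (P ** (A - B)) = trace (P ** A) - trace (P ** (B::real^'n^'n))"
  using trace_mult_add[of P "A - B" B] by simp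

lemma qform_axis: "qform A (axis i 1) = A $ i $ i"
  by (simp add: qform_def inner_axis' matrix_vector_mult_basis column_def)

text \<open>Minimise the form of \<open>v - c u\<close> over c. The form is only semidefinite
  because the matrices of the Cholesky induction are; the degenerate case is separate since the
  minimiser divides by \<open>qform A u\<close>.\<close>

lemma psd_cauchy_schwarz:
  assumes A: "transpose A = A" and nn: "\<And>w. 0 \<le> qform A w"
  shows "(u \<bullet> (A *v v))\<^sup>2 \<le> qform A u * qform A v"
proof (cases "qform A u = 0")
  case False
  hence pos: "0 < qform A u" using nn[of u] by simp
  define c where "c = (u \<bullet> (A *v v)) / qform A u"
  have "0 \<le> qform A v - 2 * c * (u \<bullet> (A *v v)) + c\<^sup>2 * qform A u"
    using nn[of "v - c *\<^sub>R u"] qform_diff_scaled[OF A] by simp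
  also have "\<dots> = qform A v - (u \<bullet> (A *v v))\<^sup>2 / qform A u"
    using pos by (simp add: c_def power2_eq_square field_simps)
  finally show ?thesis using pos by (simp add: field_simps)
next
  case True
  define b where "b = u \<bullet> (A *v v)"
  have *: "0 \<le> qform A v - 2 * c * b" for c
    using nn[of "v - c *\<^sub>R u"] qform_diff_scaled[OF A] True by (simp add: b_def)
  have "b = 0"
  proof (rule ccontr)
    assume "b \<noteq> 0"
    \<comment> \<open>This value of c would make \<open>qform A v - 2 * c * b\<close> equal to
      -1.\<close>
    with *[of "(qform A v + 1) / (2 * b)"] show False by simp
  qed
  thus ?thesis using True by (simp add: b_def)
qed

lemma qform_project:
  assumes A: "transpose A = A" and u: "qform A u \<noteq> 0"
  shows "qform A (v - ((u \<bullet> (A *v v)) / qform A u) *\<^sub>R u) = qform A v - (u \<bullet> (A *v v))\<^sup>2 / qform A u"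
  using u by (simp add: qform_diff_scaled[OF A] power2_eq_square field_simps)

text \<open>Completing the square: the form of \<open>v - c u\<close> exceeds its minimum over c by
  \<open>(c * qform A u - b)^2 / qform A u\<close>.\<close>

lemma qform_project_le:
  assumes A: "transpose A = A" and u: "0 < qform A u"
  shows "qform A v - (u \<bullet> (A *v v))\<^sup>2 / qform A u \<le> qform A (v - c *\<^sub>R u)"
proof -
  define b where "b = u \<bullet> (A *v v)"
  have "0 \<le> (c * qform A u - b)\<^sup>2 / qform A u" using u by simp
  also have "\<dots> = c\<^sup>2 * qform A u - 2 * c * b + b\<^sup>2 / qform A u"
    using u by (simp add: power2_eq_square field_simps)
  finally show ?thesis by (simp add: qform_diff_scaled[OF A] b_def)
qed

section \<open>Loewner bounds preserved by a BFGS update\<close>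

lemma qform_BFGS:
  assumes "transpose A = A" "transpose G = G"
  shows "qform (BFGS A G u) v =
    qform G v - (u \<bullet> (G *v v))\<^sup>2 / qform G u + (u \<bullet> (A *v v))\<^sup>2 / qform A u"
  using assms
  by (simp add: BFGS_def qform_outer symmetric_vector_matrix symmetric_inner power2_eq_square)

lemma BFGS_symmetric:
  assumes "transpose A = A" "transpose G = G"
  shows "transpose (BFGS A G u) = BFGS A G u"
  using assms
  by (simp add: BFGS_def transpose_add transpose_diff transpose_scalar transpose_outer
      symmetric_vector_matrix)

text \<open>With \<open>w\<close> the residue of \<open>v\<close> projected off \<open>u\<close> in
  the \<open>G\<close> form, the removed term of the update is matched exactly, while the
  \<open>A\<close> form of \<open>w\<close> is at least its own minimum along \<open>u\<close>. What
  remains is \<open>c * e <= e\<close>, hence \<open>c <= 1\<close>.\<close>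

lemma BFGS_lower:
  assumes A: "posdef A" and G: "posdef G" and u: "u \<noteq> 0" and c: "0 < c" "c \<le> 1"
    and le: "\<And>w. c * qform A w \<le> qform G w"
  shows "c * qform A v \<le> qform (BFGS A G u) v"
proof -
  note sA = posdef_sym[OF A] and sG = posdef_sym[OF G]
  have pA: "0 < qform A u" and pG: "0 < qform G u" using A G u posdef_pos by auto
  define e where "e = (u \<bullet> (A *v v))\<^sup>2 / qform A u"
  have e: "0 \<le> e" using pA by (simp add: e_def)
  define w where "w = v - ((u \<bullet> (G *v v)) / qform G u) *\<^sub>R u"
  have "c * qform A v - c * e = c * (qform A v - e)" by (simp add: algebra_simps)
  also have "\<dots> \<le> c * qform A w"
    unfolding w_def e_def using c qform_project_le[OF sA pA] by (intro mult_left_mono) auto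
  also have "\<dots> \<le> qform G w" by (rule le)
  also have "\<dots> = qform G v - (u \<bullet> (G *v v))\<^sup>2 / qform G u"
    unfolding w_def using qform_project[OF sG] pG by auto
  also have "\<dots> = qform (BFGS A G u) v - e"
    by (simp add: qform_BFGS[OF sA sG] e_def)
  finally have "c * qform A v - c * e \<le> qform (BFGS A G u) v - e" .
  moreover have "c * e \<le> e" using e c by (simp add: mult_left_le_one_le)
  ultimately show ?thesis by simp
qed

text \<open>Dual to the lower bound: \<open>w\<close> now projects in the \<open>A\<close> form, the
  \<open>G\<close> form enters through its minimum, and \<open>e <= c * e\<close> calls for
  \<open>1 <= c\<close>.\<close>

lemma BFGS_upper:
  assumes A: "posdef A" and G: "posdef G" and u: "u \<noteq> 0" and c: "1 \<le> c"
    and le: "\<And>w. qform G w \<le> c * qform A w"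
  shows "qform (BFGS A G u) v \<le> c * qform A v"
proof -
  note sA = posdef_sym[OF A] and sG = posdef_sym[OF G]
  have pA: "0 < qform A u" and pG: "0 < qform G u" using A G u posdef_pos by auto
  define e where "e = (u \<bullet> (A *v v))\<^sup>2 / qform A u"
  have e: "0 \<le> e" using pA by (simp add: e_def)
  define w where "w = v - ((u \<bullet> (A *v v)) / qform A u) *\<^sub>R u"
  have "qform (BFGS A G u) v - e = qform G v - (u \<bullet> (G *v v))\<^sup>2 / qform G u"
    by (simp add: qform_BFGS[OF sA sG] e_def)
  also have "\<dots> \<le> qform G w"
    unfolding w_def by (rule qform_project_le[OF sG pG])
  also have "\<dots> \<le> c * qform A w" by (rule le)
  also have "\<dots> = c * (qform A v - e)"
    unfolding w_def e_def using qform_project[OF sA] pA by auto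
  also have "\<dots> = c * qform A v - c * e" by (simp add: algebra_simps)
  finally have "qform (BFGS A G u) v - e \<le> c * qform A v - c * e" .
  moreover have "e \<le> c * e" using e c by (simp add: mult_le_cancel_right1)
  ultimately show ?thesis by simp
qed

lemma posdef_BFGS:
  assumes A: "posdef A" and G: "posdef G" and u: "u \<noteq> 0" and c: "0 < c" "c \<le> 1"
    and le: "\<And>w. c * qform A w \<le> qform G w"
  shows "posdef (BFGS A G u)"
  unfolding posdef_def
proof (intro conjI allI impI)
  show "transpose (BFGS A G u) = BFGS A G u"
    using A G by (simp add: BFGS_symmetric posdef_sym)
  fix v :: "real^'a" assume "v \<noteq> 0"
  hence "0 < c * qform A v" using c posdef_pos[OF A] by simp
  also have "\<dots> \<le> qform (BFGS A G u) v" using BFGS_lower[OF assms] .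
  finally show "0 < qform (BFGS A G u) v" .
qed

section \<open>Inverses of positive definite matrices\<close>

lemma posdef_invertible:
  fixes A :: "real^'n^'n"
  assumes "posdef A" shows "invertible A"
proof -
  have "\<forall>x. A *v x = 0 \<longrightarrow> x = 0"
    using posdef_pos[OF assms] by (force simp: qform_def)
  thus ?thesis
    by (meson invertible_def matrix_left_invertible_ker matrix_left_right_inverse)
qed

lemma posdef_matrix_inv_mult:
  fixes A :: "real^'n^'n"
  assumes "posdef A"
  shows "A *v (matrix_inv A *v v) = v" "matrix_inv A *v (A *v v) = v"
    "A ** matrix_inv A = mat 1" "matrix_inv A ** A = mat 1"
proof -
  show 1: "A ** matrix_inv A = mat 1" "matrix_inv A ** A = mat 1"
    using someI_ex[OF posdef_invertible[OF assms, unfolded invertible_def]]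
    unfolding matrix_inv_def by blast+
  show "A *v (matrix_inv A *v v) = v" "matrix_inv A *v (A *v v) = v"
    by (simp_all add: matrix_vector_mul_assoc 1)
qed

lemma posdef_matrix_inv_sym:
  fixes A :: "real^'n^'n"
  assumes "posdef A" shows "transpose (matrix_inv A) = matrix_inv A"
proof -
  note i = posdef_matrix_inv_mult[OF assms]
  have "transpose (matrix_inv A) ** A = mat 1"
    by (metis i(3) matrix_transpose_mul posdef_sym[OF assms] transpose_mat)
  thus ?thesis by (metis i(3) matrix_mul_assoc matrix_mul_lid matrix_mul_rid)
qed

lemma posdef_matrix_inv:
  fixes A :: "real^'n^'n"
  assumes A: "posdef A" shows "posdef (matrix_inv A)"
  unfolding posdef_def
proof (intro conjI allI impI posdef_matrix_inv_sym[OF A])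
  fix v :: "real^'n" assume v: "v \<noteq> 0"
  note i = posdef_matrix_inv_mult[OF A]
  have "matrix_inv A *v v \<noteq> 0" using i(1)[of v] v by auto
  hence "0 < qform A (matrix_inv A *v v)" using posdef_pos[OF A] by blast
  thus "0 < qform (matrix_inv A) v" by (simp add: qform_def i inner_commute)
qed

lemma qform_matrix_inv_image:
  assumes "posdef A" shows "qform (matrix_inv A) (A *v v) = qform A v"
  by (simp add: qform_def posdef_matrix_inv_mult[OF assms] inner_commute)

lemma qform_at_matrix_inv:
  assumes "posdef A" shows "qform A (matrix_inv A *v v) = qform (matrix_inv A) v"
  by (simp add: qform_def posdef_matrix_inv_mult[OF assms] inner_commute)

lemma inner_sq_le_dual:
  assumes A: "posdef A"
  shows "(u \<bullet> v)\<^sup>2 \<le> qform A u * qform (matrix_inv A) v"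
  using psd_cauchy_schwarz[OF posdef_sym[OF A] posdef_nonneg[OF A], of u "matrix_inv A *v v"]
  by (simp add: posdef_matrix_inv_mult[OF A] qform_at_matrix_inv[OF A])

text \<open>At \<open>u = matrix_inv B *v v\<close> both \<open>u \<bullet> v\<close> and
  \<open>qform B u\<close> equal \<open>b\<close>, so dual Cauchy--Schwarz reads
  \<open>b^2 <= qform A u * a <= c * b * a\<close>, and one factor \<open>b\<close> cancels.\<close>

lemma matrix_inv_antimono:
  assumes A: "posdef A" and B: "posdef B" and c: "0 < c"
    and le: "\<And>v. qform A v \<le> c * qform B v"
  shows "qform (matrix_inv B) v \<le> c * qform (matrix_inv A) v"
proof -
  define u where "u = matrix_inv B *v v"
  define b where "b = qform (matrix_inv B) v"
  define a where "a = qform (matrix_inv A) v"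
  have b: "0 \<le> b" "u \<bullet> v = b" "qform B u = b"
    using posdef_nonneg[OF posdef_matrix_inv[OF B]] qform_at_matrix_inv[OF B]
    by (auto simp: b_def u_def qform_def inner_commute)
  have a: "0 \<le> a" using posdef_nonneg[OF posdef_matrix_inv[OF A]] by (simp add: a_def)
  have "b\<^sup>2 \<le> qform A u * a" using inner_sq_le_dual[OF A, of u v] b by (simp add: a_def)
  also have "\<dots> \<le> (c * b) * a" using le[of u] b a by (intro mult_right_mono) auto
  finally have "b * b \<le> b * (c * a)" by (simp add: power2_eq_square algebra_simps)
  hence "b \<le> c * a" using b(1) a c
    by (cases "b = 0") (auto simp: mult_le_cancel_left)
  thus ?thesis by (simp add: a_def b_def)
qed

section \<open>Traces of products with semidefinite matrices\<close>

lemma psd_diag_zero_imp_0: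
  fixes S :: "real^'n^'n"
  assumes S: "transpose S = S" and nn: "\<And>w. 0 \<le> qform S w" and d: "\<And>i. S $ i $ i = 0"
  shows "S = 0"
proof -
  have "S $ i $ j = 0" for i j
  proof -
    \<comment> \<open>At two basis vectors, Cauchy--Schwarz bounds a squared entry by a product of
      diagonal entries.\<close>
    have "(axis i 1 \<bullet> (S *v axis j 1))\<^sup>2 \<le> qform S (axis i 1) * qform S (axis j 1)"
      by (rule psd_cauchy_schwarz[OF S nn])
    thus ?thesis
      by (simp add: qform_axis d inner_axis' matrix_vector_mult_basis column_def)
  qed
  thus ?thesis by (simp add: vec_eq_iff)
qed

text \<open>Subtracting \<open>S u u\<^sup>T S / u\<^sup>T S u\<close> with \<open>u\<close> a basis vector (one Cholesky step) keeps \<open>S\<close>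
  positive semidefinite and kills one more diagonal entry.\<close>

lemma trace_mult_psd_nonneg:
  fixes P S :: "real^'n^'n"
  assumes "transpose S = S" "\<And>w. 0 \<le> qform S w" and P: "\<And>w. 0 \<le> qform P w"
  shows "0 \<le> trace (P ** S)"
  using assms(1,2)
proof (induction "card {i. S $ i $ i \<noteq> 0}" arbitrary: S rule: less_induct)
  case less
  note S = less.prems(1) and nn = less.prems(2)
  show ?case
  proof (cases "\<forall>i. S $ i $ i = 0")
    case True
    hence "S = 0" using psd_diag_zero_imp_0[OF S nn] by blast
    thus ?thesis by (simp add: trace_def matrix_matrix_mult_def)
  next
    case False
    then obtain k where k: "S $ k $ k \<noteq> 0" by auto
    define u :: "real^'n" where "u = axis k 1"
    have uS: "qform S u = S $ k $ k" by (simp add: u_def qform_axis)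
    have pos: "0 < qform S u" using nn[of u] k uS by simp
    define T where "T = S - (1 / qform S u) *\<^sub>R outer (S *v u) (S *v u)"
    have T: "transpose T = T"
      by (simp add: T_def transpose_diff transpose_scalar transpose_outer S)
    have qT: "qform T w = qform S w - (u \<bullet> (S *v w))\<^sup>2 / qform S u" for w
      by (simp add: T_def qform_outer symmetric_inner[OF S] power2_eq_square)
    have nnT: "0 \<le> qform T w" for w
      using qform_project[OF S, of u w] pos nn by (metis qT less_irrefl)
    have le: "qform T w \<le> qform S w" for w
      using pos by (simp add: qT)
    have Tk: "T $ k $ k = 0"
      using qT[of u] pos by (simp add: u_def qform_axis power2_eq_square flip: qform_def)
    \<comment> \<open>Since \<open>T\<close> lies between 0 and \<open>S\<close>, zero diagonal
      entries of \<open>S\<close> stay zero in \<open>T\<close>; entry \<open>k\<close> is a new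
      zero, so the induction measure drops.\<close>
    have sub: "{i. T $ i $ i \<noteq> 0} \<subseteq> {i. S $ i $ i \<noteq> 0}"
      using le nnT by (metis (mono_tags, lifting) Collect_mono qform_axis order_antisym)
    have "{i. T $ i $ i \<noteq> 0} \<subset> {i. S $ i $ i \<noteq> 0}"
      using sub Tk k by blast
    hence "card {i. T $ i $ i \<noteq> 0} < card {i. S $ i $ i \<noteq> 0}"
      by (intro psubset_card_mono) auto
    hence T0: "0 \<le> trace (P ** T)" using less.hyps T nnT by blast
    have "S = T + (1 / qform S u) *\<^sub>R outer (S *v u) (S *v u)" by (simp add: T_def)
    hence "trace (P ** S) = trace (P ** T) + (1 / qform S u) * qform P (S *v u)"
      by (metis trace_mult_add trace_mult_scaleR trace_mult_outer qform_def)
    thus ?thesis using T0 pos P by simp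
  qed
qed

lemma trace_mult_mono_right:
  fixes P A B :: "real^'n^'n"
  assumes "transpose A = A" "transpose B = B" "\<And>w. qform A w \<le> qform B w"
    and "\<And>w. 0 \<le> qform P w"
  shows "trace (P ** A) \<le> trace (P ** B)"
  using trace_mult_psd_nonneg[of "B - A" P] assms by (simp add: transpose_diff trace_mult_diff)

lemma trace_mult_mono_left:
  fixes P Q S :: "real^'n^'n"
  assumes "transpose S = S" "\<And>w. 0 \<le> qform S w" "\<And>w. qform P w \<le> qform Q w"
  shows "trace (P ** S) \<le> trace (Q ** S)"
proof -
  have "0 \<le> trace ((Q - P) ** S)" using assms by (intro trace_mult_psd_nonneg) auto
  thus ?thesis by (metis trace_mul_sym trace_mult_diff diff_ge_0_iff_ge)
qed

text \<open>The added term always contributes \<open>u^T A u / u^T A u = 1\<close>.\<close>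

lemma trace_BFGS:
  assumes A: "posdef A" and G: "posdef G" and u: "u \<noteq> 0"
  shows "trace (matrix_inv A ** BFGS A G u) =
    trace (matrix_inv A ** G) - qform (matrix_inv A) (G *v u) / qform G u + 1"
proof -
  have "0 < qform A u" using posdef_pos A u by blast
  thus ?thesis
    by (simp add: BFGS_def trace_mult_add trace_mult_diff trace_mult_scaleR trace_mult_outer
        symmetric_vector_matrix posdef_sym A G posdef_matrix_inv_mult[OF A] inner_commute
        flip: qform_def)
qed

text \<open>For \<open>A \<preceq> G\<close> with \<open>\<mu> I \<preceq> A \<preceq> L I\<close>: the largest ratio \<open>R\<close> satisfies
  \<open>d L (R - 1) \<ge> tr (G - A) \<ge> \<mu> tr (A\<^sup>-\<^sup>1 (G - A))\<close>, and by Cauchy--Schwarz the update decreases the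
  trace by at least \<open>R - 1\<close>.\<close>

lemma greedy_trace_decrease:
  fixes A G :: "real^'n^'n" and mu L :: real
  assumes A: "posdef A" and G: "posdef G" and mu: "0 < mu" "0 < L"
    and muA: "\<And>v. mu * (v \<bullet> v) \<le> qform A v" and AL: "\<And>v. qform A v \<le> L * (v \<bullet> v)"
    and le: "\<And>v. qform A v \<le> qform G v"
    and mx: "\<And>j. greedy_ratio A G j \<le> greedy_ratio A G k"
  shows "trace (matrix_inv A ** BFGS A G (axis k 1)) - CARD('n)
    \<le> (1 - mu / (CARD('n) * L)) * (trace (matrix_inv A ** G) - CARD('n))"
proof -
  define u :: "real^'n" where "u = axis k 1"
  have u: "u \<noteq> 0" by (simp add: u_def axis_eq_0_iff)
  have pA: "0 < qform A u" and pG: "0 < qform G u" using A G u posdef_pos by auto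
  define R where "R = qform G u / qform A u"
  define s where "s = trace (matrix_inv A ** G) - CARD('n)"
  define d where "d = real CARD('n)"
  have d: "0 < d" by (simp add: d_def)
  have R1: "1 \<le> R" using le[of u] pA by (simp add: R_def)
  have sA: "s = trace (matrix_inv A ** (G - A))"
    by (simp add: s_def trace_mult_diff posdef_matrix_inv_mult[OF A] trace_I)
  have inv: "qform (matrix_inv A) v \<le> qform ((1 / mu) *\<^sub>R mat 1) v" for v
  proof -
    have m1: "matrix_inv (mat 1 :: real^'n^'n) = mat 1"
      using posdef_matrix_inv_mult(3)[OF posdef_mat_1] by simp
    show ?thesis
      using matrix_inv_antimono[OF posdef_mat_1 A, of "1/mu" v] mu muA
      by (simp add: m1 field_simps)
  qed
  have "s \<le> trace (((1 / mu) *\<^sub>R mat 1) ** (G - A))"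
    unfolding sA using inv le posdef_sym[OF A] posdef_sym[OF G]
    by (intro trace_mult_mono_left) (auto simp: transpose_diff)
  also have "\<dots> = trace (G - A) / mu"
    by (metis trace_mul_sym trace_mult_scaleR matrix_mul_rid mult.commute times_divide_eq_right
        mult.right_neutral)
  finally have 1: "mu * s \<le> trace (G - A)" using mu by (simp add: field_simps)
  have "(G - A) $ j $ j \<le> L * (R - 1)" for j
  proof -
    have pj: "0 < qform A (axis j 1)" using posdef_pos[OF A] by (simp add: axis_eq_0_iff)
    have "qform G (axis j 1) / qform A (axis j 1) \<le> R"
      using mx[of j] by (simp add: greedy_ratio_def R_def u_def)
    hence "qform G (axis j 1) - qform A (axis j 1) \<le> (R - 1) * qform A (axis j 1)"
      using pj by (simp add: field_simps)
    also have "\<dots> \<le> (R - 1) * L"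
      using AL[of "axis j 1"] R1 by (intro mult_left_mono) (auto simp: inner_axis_axis)
    finally show ?thesis by (simp add: qform_axis mult.commute)
  qed
  hence "trace (G - A) \<le> (\<Sum>j\<in>(UNIV::'n set). L * (R - 1))"
    unfolding trace_def by (intro sum_mono) auto
  hence "mu * s \<le> d * (L * (R - 1))" using 1 by (simp add: d_def)
  hence Rs: "mu / (d * L) * s \<le> R - 1" using d mu by (simp add: field_simps)
  have "(u \<bullet> (G *v u))\<^sup>2 \<le> qform A u * qform (matrix_inv A) (G *v u)"
    by (rule inner_sq_le_dual[OF A])
  hence "R \<le> qform (matrix_inv A) (G *v u) / qform G u"
    using pA pG by (simp add: R_def field_simps power2_eq_square flip: qform_def)
  hence "trace (matrix_inv A ** BFGS A G u) - CARD('n) \<le> s - (R - 1)"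
    by (simp add: trace_BFGS[OF A G u] s_def)
  also have "\<dots> \<le> s - mu / (d * L) * s" using Rs by simp
  finally show ?thesis by (simp add: u_def s_def d_def algebra_simps)
qed

text \<open>Polarise \<open>D\<close>, bound both squares by \<open>P\<close>, and apply the
  parallelogram law to \<open>P\<close>. The right side is a sum instead of a product; scaling
  \<open>y\<close> suitably recovers the strength of Cauchy--Schwarz.\<close>

lemma psd_bilinear_bound:
  assumes D: "transpose D = D" and P: "transpose P = P"
    and b: "\<And>v. \<bar>qform D v\<bar> \<le> m * qform P v"
  shows "2 * (y \<bullet> (D *v z)) \<le> m * (qform P y + qform P z)"
proof -
  have pl: "4 * (y \<bullet> (A *v z)) = qform A (y + z) - qform A (y - z)"
           "qform A (y + z) + qform A (y - z) = 2 * (qform A y + qform A z)"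
    if "transpose A = A" for A :: "real^'a^'a"
    using qform_add_scaled[OF that, of y 1 z] qform_add_scaled[OF that, of y "-1" z]
      symmetric_inner_commute[OF that, of y z] by simp_all
  have "4 * (y \<bullet> (D *v z)) = qform D (y + z) - qform D (y - z)" using pl(1)[OF D] .
  also have "\<dots> \<le> m * qform P (y + z) + m * qform P (y - z)"
    using b[of "y + z"] b[of "y - z"] by linarith
  also have "\<dots> = m * (2 * (qform P y + qform P z))"
    unfolding pl(2)[OF P, symmetric] by (rule distrib_left[symmetric])
  finally show ?thesis by (simp add: algebra_simps)
qed

text \<open>With \<open>z = g x\<close> the vector on the left is the gradient after the
  quasi-Newton step; this drives linear convergence. It equals \<open>J *v p\<close> with
  \<open>p = D *v z\<close>.\<close>

lemma inverse_difference_bound: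
  assumes J: "posdef J" and G: "posdef G" and m: "0 < m"
    and b: "\<And>v. \<bar>qform (matrix_inv J - matrix_inv G) v\<bar> \<le> m * qform (matrix_inv J) v"
  shows "qform (matrix_inv J) (z - J *v (matrix_inv G *v z)) \<le> m\<^sup>2 * qform (matrix_inv J) z"
proof -
  define D where "D = matrix_inv J - matrix_inv G"
  define p where "p = D *v z"
  note Ji = posdef_matrix_inv_mult[OF J]
  have Jp: "z - J *v (matrix_inv G *v z) = J *v p"
    by (simp add: p_def D_def matrix_vector_mult_diff_rdistrib matrix_vector_mult_diff_distrib Ji)
  have sD: "transpose D = D"
    by (simp add: D_def transpose_diff posdef_matrix_inv_sym J G)
  define n where "n = qform J p"
  have n: "qform (matrix_inv J) (J *v p) = n" by (simp add: n_def qform_matrix_inv_image[OF J])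
  \<comment> \<open>The scaling 1/m yields
    \<open>2 * n / m <= n / m + m * qform (matrix_inv J) z\<close>, so half of the left side is
    absorbed.\<close>
  have "2 * (((1/m) *\<^sub>R (J *v p)) \<bullet> (D *v z))
      \<le> m * (qform (matrix_inv J) ((1/m) *\<^sub>R (J *v p)) + qform (matrix_inv J) z)"
    using b by (intro psd_bilinear_bound[OF sD posdef_matrix_inv_sym[OF J]]) (simp add: D_def)
  also have "((1/m) *\<^sub>R (J *v p)) \<bullet> (D *v z) = n / m"
    by (simp add: n_def qform_def inner_commute flip: p_def)
  finally have "2 * (n / m) \<le> m * ((1/m)\<^sup>2 * n + qform (matrix_inv J) z)"
    by (simp only: qform_scale_arg n)
  hence "n \<le> m\<^sup>2 * qform (matrix_inv J) z"
    using m by (simp add: field_simps power2_eq_square)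
  thus ?thesis by (simp add: Jp n)
qed

section \<open>Hessians of strongly self-concordant functions\<close>

lemma directional_derivative_along_line:
  fixes f :: "real^'n \<Rightarrow> real"
  assumes "\<And>y. (f has_derivative (\<lambda>h. g y \<bullet> h)) (at y)"
  shows "((\<lambda>s. f (y + s *\<^sub>R v)) has_real_derivative (g (y + s *\<^sub>R v) \<bullet> v)) (at s within S)"
proof -
  have "((\<lambda>s. y + s *\<^sub>R v) has_derivative (\<lambda>h. h *\<^sub>R v)) (at s within S)"
    by (auto intro!: derivative_eq_intros)
  from has_derivative_compose[OF this assms]
  have "((\<lambda>s. f (y + s *\<^sub>R v)) has_derivative (\<lambda>h. g (y + s *\<^sub>R v) \<bullet> (h *\<^sub>R v))) (at s within S)" .
  thus ?thesis by (simp add: has_field_derivative_def mult_commute_abs)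
qed

text \<open>The second difference of \<open>f\<close> is symmetric in \<open>u\<close> and \<open>v\<close>; this gives the symmetry of the
  Hessian without any continuity of \<open>H\<close>.\<close>

lemma second_difference_approx:
  fixes f :: "real^'n \<Rightarrow> real"
  assumes grad: "\<And>y. (f has_derivative (\<lambda>h. g y \<bullet> h)) (at y)"
    and appr: "\<And>z. norm z < \<delta> \<Longrightarrow> norm (g (y + z) - g y - H *v z) \<le> e * norm z"
    and h: "0 < h" "h * C < \<delta>" and C: "norm u + norm v \<le> C" and e: "0 \<le> e"
  shows "\<bar>f (y + h *\<^sub>R u + h *\<^sub>R v) - f (y + h *\<^sub>R u) - f (y + h *\<^sub>R v) + f y
      - h\<^sup>2 * (v \<bullet> (H *v u))\<bar> \<le> 2 * e * h\<^sup>2 * C\<^sup>2"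
proof -
  define p where "p = (\<lambda>s. f ((y + h *\<^sub>R u) + s *\<^sub>R v) - f (y + s *\<^sub>R v))"
  have "(p has_real_derivative (g ((y + h *\<^sub>R u) + s *\<^sub>R v) \<bullet> v - g (y + s *\<^sub>R v) \<bullet> v)) (at s)" for s
    unfolding p_def
    by (intro DERIV_diff directional_derivative_along_line grad)
  \<comment> \<open>The mean value theorem is used in direction \<open>v\<close> only; the two
    gradients it produces are then expanded to first order at \<open>y\<close>, the one point where
    an expansion is given.\<close>
  from MVT2[OF h(1) this] obtain s where s: "0 < s" "s < h"
    and ps: "p h - p 0 = (h - 0) * (g ((y + h *\<^sub>R u) + s *\<^sub>R v) \<bullet> v - g (y + s *\<^sub>R v) \<bullet> v)"
    by blast
  define z1 where "z1 = h *\<^sub>R u + s *\<^sub>R v"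
  define z2 where "z2 = s *\<^sub>R v"
  have C0: "0 \<le> C" using C norm_ge_zero[of u] norm_ge_zero[of v] by linarith
  have sv: "s * norm v \<le> h * norm v" using s by (intro mult_right_mono) auto
  have hC: "h * norm u + h * norm v \<le> h * C"
    using C h by (metis distrib_left less_imp_le mult_left_mono)
  have n1: "norm z1 \<le> h * C"
    using norm_triangle_ineq[of "h *\<^sub>R u" "s *\<^sub>R v"] sv hC h s by (simp add: z1_def)
  have n2: "norm z2 \<le> h * C"
    using sv hC h s by (simp add: z2_def) (smt (verit) mult_nonneg_nonneg norm_ge_zero)
  define E where "E = (g (y + z1) - g y - H *v z1) - (g (y + z2) - g y - H *v z2)"
  have "norm (g (y + z1) - g y - H *v z1) \<le> e * (h * C)"
    using appr[of z1] n1 h e by (smt (verit) mult_left_mono)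
  moreover have "norm (g (y + z2) - g y - H *v z2) \<le> e * (h * C)"
    using appr[of z2] n2 h e by (smt (verit) mult_left_mono)
  ultimately have nE: "norm E \<le> 2 * e * h * C"
    unfolding E_def by (intro order_trans[OF norm_triangle_ineq4]) linarith
  have diff: "g ((y + h *\<^sub>R u) + s *\<^sub>R v) - g (y + s *\<^sub>R v) = h *\<^sub>R (H *v u) + E"
    by (simp add: E_def z1_def z2_def matrix_vector_right_distrib matrix_vector_mult_scaleR
        algebra_simps)
  have "p h - p 0 = h * ((g ((y + h *\<^sub>R u) + s *\<^sub>R v) - g (y + s *\<^sub>R v)) \<bullet> v)"
    using ps by (simp add: inner_diff_left)
  also have "\<dots> = h\<^sup>2 * (v \<bullet> (H *v u)) + h * (E \<bullet> v)"
    unfolding diff by (simp add: inner_add_left inner_commute power2_eq_square algebra_simps)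
  finally have "\<bar>p h - p 0 - h\<^sup>2 * (v \<bullet> (H *v u))\<bar> = h * \<bar>E \<bullet> v\<bar>"
    using h by (simp add: abs_mult)
  also have "\<dots> \<le> h * (norm E * norm v)"
    using h Cauchy_Schwarz_ineq2 by (intro mult_left_mono) auto
  also have "\<dots> \<le> h * ((2 * e * h * C) * C)"
  proof -
    have "norm v \<le> C" using C norm_ge_zero[of u] by linarith
    thus ?thesis using nE h e C0 by (intro mult_left_mono mult_mono) auto
  qed
  finally show ?thesis by (simp add: p_def power2_eq_square algebra_simps)
qed

lemma hessian_symmetric:
  fixes f :: "real^'n \<Rightarrow> real"
  assumes grad: "\<And>y. (f has_derivative (\<lambda>h. g y \<bullet> h)) (at y)"
    and hess: "(g has_derivative (\<lambda>h. H *v h)) (at y)"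
  shows "transpose H = H"
proof -
  have sym: "v \<bullet> (H *v u) = u \<bullet> (H *v v)" for u v
  proof -
    define C where "C = norm u + norm v + 1"
    have C: "0 < C" by (simp add: C_def add_nonneg_pos)
    have "\<bar>v \<bullet> (H *v u) - u \<bullet> (H *v v)\<bar> \<le> 0 + e" if "0 < e" for e
    proof -
      \<comment> \<open>Two errors of \<open>2 * e' * h^2 * C^2\<close> must add up to
        \<open>h^2 * e\<close>.\<close>
      define e' where "e' = e / (4 * C\<^sup>2)"
      have e': "0 < e'" using that C by (simp add: e'_def)
      obtain \<delta> where \<delta>: "0 < \<delta>"
        "\<And>w. norm (w - y) < \<delta> \<Longrightarrow> norm (g w - g y - H *v (w - y)) \<le> e' * norm (w - y)"
        using hess e' unfolding has_derivative_at_alt by meson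
      have appr: "norm (g (y + z) - g y - H *v z) \<le> e' * norm z" if "norm z < \<delta>" for z
        using \<delta>(2)[of "y + z"] that by simp
      define h where "h = \<delta> / (2 * C)"
      have h: "0 < h" "h * C < \<delta>" using C \<delta> by (auto simp: h_def)
      let ?\<phi> = "f (y + h *\<^sub>R u + h *\<^sub>R v) - f (y + h *\<^sub>R u) - f (y + h *\<^sub>R v) + f y"
      have 1: "\<bar>?\<phi> - h\<^sup>2 * (v \<bullet> (H *v u))\<bar> \<le> 2 * e' * h\<^sup>2 * C\<^sup>2"
        using e' by (intro second_difference_approx[OF grad appr h]) (auto simp: C_def)
      have "\<bar>f (y + h *\<^sub>R v + h *\<^sub>R u) - f (y + h *\<^sub>R v) - f (y + h *\<^sub>R u) + f y
          - h\<^sup>2 * (u \<bullet> (H *v v))\<bar> \<le> 2 * e' * h\<^sup>2 * C\<^sup>2"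
        using e' by (intro second_difference_approx[OF grad appr h]) (auto simp: C_def)
      hence 2: "\<bar>?\<phi> - h\<^sup>2 * (u \<bullet> (H *v v))\<bar> \<le> 2 * e' * h\<^sup>2 * C\<^sup>2"
        by (simp add: algebra_simps)
      have "h\<^sup>2 * \<bar>v \<bullet> (H *v u) - u \<bullet> (H *v v)\<bar>
          = \<bar>h\<^sup>2 * (v \<bullet> (H *v u)) - h\<^sup>2 * (u \<bullet> (H *v v))\<bar>"
        by (simp add: abs_mult flip: right_diff_distrib)
      also have "\<dots> \<le> 4 * e' * h\<^sup>2 * C\<^sup>2" using 1 2 by linarith
      also have "\<dots> = h\<^sup>2 * e" using C by (simp add: e'_def)
      finally show ?thesis using h by simp
    qed
    hence "\<bar>v \<bullet> (H *v u) - u \<bullet> (H *v v)\<bar> \<le> 0" by (rule field_le_epsilon)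
    thus ?thesis by simp
  qed
  have "H $ i $ j = H $ j $ i" for i j
    using sym[of "axis i 1" "axis j 1"]
    by (simp add: inner_axis' matrix_vector_mult_basis column_def)
  thus ?thesis by (simp add: transpose_def vec_eq_iff)
qed

text \<open>Subtracting the quadratic leaves the convex \<open>F\<close>. Adding its tangent
  inequalities at \<open>y\<close> and at \<open>z\<close> makes \<open>G\<close> monotone, and the
  subtracted part returns as the \<open>mu\<close> term.\<close>

lemma strongly_convex_gradient_monotone:
  fixes f :: "real^'n \<Rightarrow> real"
  assumes grad: "\<And>y. (f has_derivative (\<lambda>h. g y \<bullet> h)) (at y)"
    and sc: "strongly_convex_on UNIV mu f"
  shows "mu * (norm (z - y))\<^sup>2 \<le> (g z - g y) \<bullet> (z - y)"
proof -
  define F where "F = (\<lambda>x. f x - mu / 2 * (norm x)\<^sup>2)"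
  define G where "G = (\<lambda>x. g x - mu *\<^sub>R x)"
  have F: "convex_on UNIV F" using sc by (simp add: strongly_convex_on_def F_def)
  have dF: "(F has_derivative (\<lambda>h. G y \<bullet> h)) (at y)" for y
    unfolding F_def G_def power2_norm_eq_inner
    by (rule derivative_eq_intros grad refl)+
      (auto simp: inner_diff_left inner_commute algebra_simps)
  have first_order: "G y \<bullet> (z - y) \<le> F z - F y" for y z
  proof -
    \<comment> \<open>Along the line, \<open>F\<close> becomes a convex function of one variable
      with slope \<open>G y \<bullet> (z - y)\<close> at 0.\<close>
    define c where "c = (\<lambda>s::real. F (y + s *\<^sub>R (z - y)))"
    have "convex_on UNIV c"
      unfolding convex_on_def c_def
    proof (intro conjI ballI allI impI convex_UNIV)
      fix a b s t :: real assume st: "0 \<le> s" "0 \<le> t" "s + t = 1"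
      have "y + (s *\<^sub>R a + t *\<^sub>R b) *\<^sub>R (z - y) =
          s *\<^sub>R (y + a *\<^sub>R (z - y)) + t *\<^sub>R (y + b *\<^sub>R (z - y))"
        using arg_cong[OF st(3), of "\<lambda>r. r *\<^sub>R y"]
        by (simp add: algebra_simps)
      thus "F (y + (s *\<^sub>R a + t *\<^sub>R b) *\<^sub>R (z - y))
          \<le> s * F (y + a *\<^sub>R (z - y)) + t * F (y + b *\<^sub>R (z - y))"
        using F st unfolding convex_on_def by (metis UNIV_I)
    qed
    from convex_on_imp_above_tangent[OF this connected_UNIV, of 0 1]
      directional_derivative_along_line[OF dF, of y "z - y" 0 UNIV]
    show ?thesis by (simp add: c_def)
  qed
  have "0 \<le> (G z - G y) \<bullet> (z - y)"
    using first_order[of y z] first_order[of z y]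
    by (simp add: inner_diff_left inner_diff_right)
  thus ?thesis
    by (simp add: G_def power2_norm_eq_inner inner_diff_left inner_diff_right algebra_simps)
qed

locale self_concordant =
  fixes f :: "real^'n \<Rightarrow> real"
    and g :: "real^'n \<Rightarrow> real^'n"
    and H :: "real^'n \<Rightarrow> real^'n^'n"
    and mu L M :: real
  assumes grad: "\<And>y. (f has_derivative (\<lambda>h. g y \<bullet> h)) (at y)"
    and hess: "\<And>y. (g has_derivative (\<lambda>h. H y *v h)) (at y)"
    and mu_pos: "0 < mu" and mu_le_L: "mu \<le> L" and M_pos: "0 < M"
    and sconv: "strongly_convex_on UNIV mu f"
    and lip: "L-lipschitz_on UNIV g"
    and ssc: "strongly_self_concordant M H"
begin

lemma H_sym: "transpose (H y) = H y"
  by (rule hessian_symmetric[OF grad hess])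

lemma gradient_along_line:
  "((\<lambda>s. g (y + s *\<^sub>R v)) has_vector_derivative (H (y + s *\<^sub>R v) *v v)) (at s within S)"
proof -
  have "((\<lambda>s. y + s *\<^sub>R v) has_derivative (\<lambda>h. h *\<^sub>R v)) (at s within S)"
    by (auto intro!: derivative_eq_intros)
  from has_derivative_compose[OF this hess]
  show ?thesis by (simp add: has_vector_derivative_def matrix_vector_mult_scaleR)
qed

text \<open>The form of \<open>H y\<close> at \<open>v\<close> is a limit of difference quotients of
  \<open>g\<close> along \<open>v\<close>. Strong monotonicity bounds each quotient below, the
  Lipschitz constant above.\<close>

lemma H_bounds: "mu * (v \<bullet> v) \<le> qform (H y) v" "qform (H y) v \<le> L * (v \<bullet> v)"
proof -
  define k where "k = (\<lambda>s. g (y + s *\<^sub>R v) \<bullet> v)"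
  have "((\<lambda>s. g (y + s *\<^sub>R v)) has_derivative (\<lambda>h. h *\<^sub>R (H y *v v))) (at 0)"
    using gradient_along_line[of y v 0 UNIV] by (simp add: has_vector_derivative_def)
  hence "(k has_derivative (\<lambda>h. (h *\<^sub>R (H y *v v)) \<bullet> v)) (at 0)"
    unfolding k_def by (rule has_derivative_inner_left)
  hence "(k has_real_derivative qform (H y) v) (at 0)"
    by (simp add: has_field_derivative_def qform_def inner_commute mult_commute_abs)
  hence lim: "((\<lambda>s. (k s - k 0) / s) \<longlongrightarrow> qform (H y) v) (at 0)"
    by (simp add: has_field_derivative_iff)
  \<comment> \<open>Multiplying by \<open>s^2\<close> instead of \<open>s\<close> avoids a case
    split on the sign of \<open>s\<close>.\<close>
  have sq: "s\<^sup>2 * (q / s) = s * q" if "s \<noteq> 0" for s q :: real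
    using that by (simp add: power2_eq_square)
  have lo: "mu * (v \<bullet> v) \<le> (k s - k 0) / s" if "s \<noteq> 0" for s
  proof -
    have "mu * (s\<^sup>2 * (v \<bullet> v)) \<le> s * (k s - k 0)"
      using strongly_convex_gradient_monotone[OF grad sconv, of "y + s *\<^sub>R v" y,
          unfolded power2_norm_eq_inner]
      by (simp add: k_def inner_diff_left power2_eq_square algebra_simps)
    hence "s\<^sup>2 * (mu * (v \<bullet> v)) \<le> s\<^sup>2 * ((k s - k 0) / s)"
      unfolding sq[OF that] by (simp only: mult.left_commute)
    thus ?thesis by (rule mult_left_le_imp_le) (simp add: that)
  qed
  have up: "(k s - k 0) / s \<le> L * (v \<bullet> v)" if "s \<noteq> 0" for s
  proof -
    have "s * (k s - k 0) = (g (y + s *\<^sub>R v) - g y) \<bullet> (s *\<^sub>R v)"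
      by (simp add: k_def inner_diff_left)
    also have "\<dots> \<le> norm (g (y + s *\<^sub>R v) - g y) * norm (s *\<^sub>R v)"
      by (rule norm_cauchy_schwarz)
    also have "\<dots> \<le> (L * norm (s *\<^sub>R v)) * norm (s *\<^sub>R v)"
      using lipschitz_onD[OF lip, of "y + s *\<^sub>R v" y]
      by (intro mult_right_mono) (auto simp: dist_norm)
    also have "\<dots> = s\<^sup>2 * (L * (v \<bullet> v))"
      by (simp add: power2_norm_eq_inner[symmetric] power2_eq_square)
    finally have "s\<^sup>2 * ((k s - k 0) / s) \<le> s\<^sup>2 * (L * (v \<bullet> v))"
      unfolding sq[OF that] .
    thus ?thesis by (rule mult_left_le_imp_le) (simp add: that)
  qed
  show "mu * (v \<bullet> v) \<le> qform (H y) v"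
    by (rule tendsto_lowerbound[OF lim]) (auto simp: eventually_at_filter lo)
  show "qform (H y) v \<le> L * (v \<bullet> v)"
    by (rule tendsto_upperbound[OF lim]) (auto simp: eventually_at_filter up)
qed

lemma posdef_H: "posdef (H y)"
  unfolding posdef_def
proof (intro conjI allI impI H_sym)
  fix v :: "real^'n" assume "v \<noteq> 0"
  hence "0 < mu * (v \<bullet> v)" using mu_pos by simp
  thus "0 < qform (H y) v" using H_bounds(1)[of v y] by simp
qed

lemma H_diff_le: "qform (H y) v - qform (H x) v \<le> M * local_norm H z (y - x) * qform (H w) v"
  using ssc by (simp add: strongly_self_concordant_def loewner_le_def)

lemma local_norm_nonneg: "0 \<le> local_norm H z v"
  by (simp add: local_norm_def posdef_nonneg[OF posdef_H])

lemma local_norm_scaleR: "local_norm H z (c *\<^sub>R v) = \<bar>c\<bar> * local_norm H z v"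
  by (simp add: local_norm_def qform_scale_arg real_sqrt_mult)

lemma local_norm_minus: "local_norm H z (- v) = local_norm H z v"
  using local_norm_scaleR[of z "-1" v] by simp

text \<open>Self-concordance used in both directions bounds the form of \<open>H y - H x\<close>
  from both sides, and polarisation at basis vectors passes to entries. This makes \<open>H\<close>
  Lipschitz.\<close>

lemma H_entry_diff: "\<bar>H y $ i $ j - H x $ i $ j\<bar> \<le> M * sqrt L * L * norm (y - x)"
proof -
  define D where "D = H y - H x"
  define m where "m = M * sqrt L * L * norm (y - x)"
  have L: "0 < L" using mu_pos mu_le_L by simp
  have ln: "local_norm H x (y - x) \<le> sqrt L * norm (y - x)"
  proof -
    have "local_norm H x (y - x) \<le> sqrt (L * ((y - x) \<bullet> (y - x)))"
      unfolding local_norm_def by (intro real_sqrt_le_mono H_bounds)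
    also have "\<dots> = sqrt L * norm (y - x)" by (simp add: real_sqrt_mult norm_eq_sqrt_inner)
    finally show ?thesis .
  qed
  have le: "M * local_norm H x (y - x) * qform (H w) v \<le> m * qform (mat 1) v" for w v
  proof -
    have "M * local_norm H x (y - x) * qform (H w) v
        \<le> (M * (sqrt L * norm (y - x))) * (L * (v \<bullet> v))"
      using M_pos L ln H_bounds(2)[of w v]
      by (intro mult_mono posdef_nonneg[OF posdef_H] mult_nonneg_nonneg local_norm_nonneg) auto
    thus ?thesis by (simp add: m_def algebra_simps)
  qed
  have b: "\<bar>qform D v\<bar> \<le> m * qform (mat 1) v" for v
    using H_diff_le[of y v x x x] H_diff_le[of x v y x x] le[of x v]
      local_norm_minus[of x "y - x"]
    by (simp add: D_def abs_le_iff)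
  have sD: "transpose D = D" by (simp add: D_def transpose_diff H_sym)
  have e: "D $ i $ j = axis i 1 \<bullet> (D *v axis j 1)"
    by (simp add: inner_axis' matrix_vector_mult_basis column_def)
  have key: "w \<bullet> (D *v axis j 1) \<le> m" if "w \<bullet> w = 1" for w
    using psd_bilinear_bound[OF sD transpose_mat b, of w "axis j 1"] that
    by (simp add: inner_axis_axis)
  have "D $ i $ j \<le> m"
    unfolding e by (rule key) (simp add: inner_axis_axis)
  moreover have "- (D $ i $ j) \<le> m"
    unfolding e inner_minus_left[symmetric] by (rule key) (simp add: inner_axis_axis)
  ultimately have "\<bar>D $ i $ j\<bar> \<le> m" by (rule abs_leI)
  thus ?thesis by (simp add: D_def m_def)
qed

text \<open>Continuity ensures that the integral defining \<open>mean_H\<close> is genuine and not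
  the default value for non-integrable functions.\<close>

lemma continuous_H: "continuous_on S H"
proof -
  have "continuous_on S (\<lambda>y. H y $ i $ j)" for i j
  proof (rule lipschitz_on_continuous_on[where L = "M * sqrt L * L"], rule lipschitz_onI)
    show "dist (H x $ i $ j) (H y $ i $ j) \<le> M * sqrt L * L * dist x y" for x y
      using H_entry_diff[of x i j y] by (simp add: dist_norm)
    show "0 \<le> M * sqrt L * L" using M_pos mu_pos mu_le_L by simp
  qed
  hence "continuous_on S (\<lambda>y. \<chi> i j. H y $ i $ j)"
    by (intro continuous_on_vec_lambda)
  thus ?thesis by simp
qed

section \<open>The averaged Hessian along a segment\<close>

definition mean_H :: "real^'n \<Rightarrow> real^'n \<Rightarrow> real^'n^'n" where
  "mean_H x y = integral {0..1} (\<lambda>\<tau>. H (x + \<tau> *\<^sub>R (y - x)))"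

lemma continuous_H_line: "continuous_on S (\<lambda>\<tau>. H (x + \<tau> *\<^sub>R v))"
  by (rule continuous_on_compose2[OF continuous_H[of UNIV]]) (auto intro!: continuous_intros)

lemma integrable_H_line: "(\<lambda>\<tau>. H (x + \<tau> *\<^sub>R v)) integrable_on {0..1}"
  by (intro integrable_continuous_interval continuous_H_line)

lemma mean_H_linear:
  fixes T :: "real^'n^'n \<Rightarrow> 'b::euclidean_space"
  assumes "linear T"
  shows "((\<lambda>\<tau>. T (H (x + \<tau> *\<^sub>R (y - x)))) has_integral T (mean_H x y)) {0..1}"
  using has_integral_linear[OF integrable_integral[OF integrable_H_line], of T] assms
  by (simp add: mean_H_def o_def linear_conv_bounded_linear)

lemma linear_transpose: "linear (transpose :: real^'n^'n \<Rightarrow> real^'n^'n)"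
  by (intro linearI) (simp_all add: transpose_add transpose_scalar)

lemma linear_mult_vector: "linear (\<lambda>A :: real^'n^'n. A *v v)"
  by (intro linearI) (simp_all add: matrix_vector_mult_add_rdistrib scaleR_matrix_vector)

lemma linear_qform: "linear (\<lambda>A. qform A v)"
  by (intro linearI) simp_all

lemma mean_H_sym: "transpose (mean_H x y) = mean_H x y"
  using has_integral_unique[OF mean_H_linear[OF linear_transpose, of x y]]
    mean_H_linear[OF linear_id, of x y]
  by (simp add: H_sym)

lemma mean_H_qform: "((\<lambda>\<tau>. qform (H (x + \<tau> *\<^sub>R (y - x))) v) has_integral qform (mean_H x y) v) {0..1}"
  by (rule mean_H_linear[OF linear_qform])

text \<open>The secant equation, from the fundamental theorem of calculus for \<open>g\<close> along
  the segment.\<close>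

lemma mean_H_step: "mean_H x y *v (y - x) = g y - g x"
proof -
  have "((\<lambda>\<tau>. H (x + \<tau> *\<^sub>R (y - x)) *v (y - x)) has_integral
      g (x + 1 *\<^sub>R (y - x)) - g (x + 0 *\<^sub>R (y - x))) {0..1}"
    by (intro fundamental_theorem_of_calculus gradient_along_line) auto
  moreover have "((\<lambda>\<tau>. H (x + \<tau> *\<^sub>R (y - x)) *v (y - x)) has_integral
      mean_H x y *v (y - x)) {0..1}"
    by (rule mean_H_linear[OF linear_mult_vector])
  ultimately have "g (x + 1 *\<^sub>R (y - x)) - g (x + 0 *\<^sub>R (y - x)) = mean_H x y *v (y - x)"
    by (rule has_integral_unique)
  thus ?thesis by simp
qed

lemma posdef_mean_H: "posdef (mean_H x y)"
  unfolding posdef_def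
proof (intro conjI allI impI mean_H_sym)
  fix v :: "real^'n" assume "v \<noteq> 0"
  hence "0 < mu * (v \<bullet> v)" using mu_pos by simp
  moreover have "((\<lambda>_::real. mu * (v \<bullet> v)) has_integral mu * (v \<bullet> v)) {0..1}"
    using has_integral_const_real[of "mu * (v \<bullet> v)" 0 1] by simp
  hence "mu * (v \<bullet> v) \<le> qform (mean_H x y) v"
    by (rule has_integral_le[OF _ mean_H_qform]) (rule H_bounds)
  ultimately show "0 < qform (mean_H x y) v" by simp
qed

text \<open>The weight \<open>\<tau>\<close> averages to 1/2, which is the origin of the 1/2 in the
  correction factor.\<close>

lemma has_integral_linear_weight:
  "((\<lambda>\<tau>::real. p + \<tau> * q) has_integral p + q / 2) {0..1}"
proof -
  have "((\<lambda>\<tau>::real. p + \<tau> * q) has_integral (p * 1 + 1\<^sup>2 / 2 * q) - (p * 0 + 0\<^sup>2 / 2 * q)) {0..1}"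
    by (intro fundamental_theorem_of_calculus)
      (auto intro!: derivative_eq_intros simp flip: has_real_derivative_iff_has_vector_derivative)
  thus ?thesis by simp
qed

text \<open>Both end points are compared with the mean through a bound that is linear in the distance
  along the segment; self-concordance with a free \<open>w\<close> lets us put the mean itself on the right.\<close>

lemma mean_H_sandwich:
  fixes x y v
  defines "a \<equiv> M * local_norm H x (y - x) / 2"
  shows "qform (mean_H x y) v \<le> (1 + a) * qform (H x) v"
    and "qform (mean_H x y) v \<le> (1 + a) * qform (H y) v"
    and "qform (H x) v \<le> (1 + a) * qform (mean_H x y) v"
    and "qform (H y) v \<le> (1 + a) * qform (mean_H x y) v"
proof -
  define h where "h = (\<lambda>\<tau>. qform (H (x + \<tau> *\<^sub>R (y - x))) v)"
  define J where "J = qform (mean_H x y) v"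
  have hJ: "(h has_integral J) {0..1}" unfolding h_def J_def by (rule mean_H_qform)
  have h0: "h 0 = qform (H x) v" and h1: "h 1 = qform (H y) v" by (auto simp: h_def)
  have hd: "h \<tau> - h \<tau>' \<le> \<bar>\<tau> - \<tau>'\<bar> * (2 * a) * h \<sigma>" for \<tau> \<tau>' \<sigma>
  proof -
    have "local_norm H x ((x + \<tau> *\<^sub>R (y - x)) - (x + \<tau>' *\<^sub>R (y - x)))
        = \<bar>\<tau> - \<tau>'\<bar> * local_norm H x (y - x)"
      by (simp add: local_norm_scaleR flip: scaleR_left_diff_distrib)
    thus ?thesis
      using H_diff_le[of "x + \<tau> *\<^sub>R (y - x)" v "x + \<tau>' *\<^sub>R (y - x)" x "x + \<sigma> *\<^sub>R (y - x)"]
      by (simp add: h_def a_def algebra_simps)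
  qed
  have J_le: "J \<le> h 0 + (2 * a * h 0) / 2"
  proof (rule has_integral_le[OF hJ has_integral_linear_weight])
    show "h \<tau> \<le> h 0 + \<tau> * (2 * a * h 0)" if "\<tau> \<in> {0..1}" for \<tau>
      using hd[of \<tau> 0 0] that by (simp add: algebra_simps)
  qed
  \<comment> \<open>The distance to this end point is \<open>1 - \<tau>\<close>, which explains the
    constant term and the negative slope.\<close>
  have J_le1: "J \<le> (h 1 + 2 * a * h 1) + (- (2 * a * h 1)) / 2"
  proof (rule has_integral_le[OF hJ has_integral_linear_weight])
    show "h \<tau> \<le> (h 1 + 2 * a * h 1) + \<tau> * (- (2 * a * h 1))" if "\<tau> \<in> {0..1}" for \<tau>
      using hd[of \<tau> 1 1] that by (simp add: abs_real_def algebra_simps split: if_splits)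
  qed
  have average: "c \<le> a * J" if "\<And>\<sigma>. c \<le> a * h \<sigma>" for c
    using has_integral_const_real[of c 0 1]
    by (intro has_integral_le[OF _ has_integral_mult_right[OF hJ]]) (auto simp: that)
  have le_J: "h 0 - J \<le> a * J"
  proof (rule average)
    fix \<sigma>
    have "h 0 + (- (2 * a * h \<sigma>)) / 2 \<le> J"
    proof (rule has_integral_le[OF has_integral_linear_weight hJ])
      show "h 0 + \<tau> * (- (2 * a * h \<sigma>)) \<le> h \<tau>" if "\<tau> \<in> {0..1}" for \<tau>
        using hd[of 0 \<tau> \<sigma>] that by (simp add: algebra_simps)
    qed
    thus "h 0 - J \<le> a * h \<sigma>" by simp
  qed
  have le_J1: "h 1 - J \<le> a * J"
  proof (rule average)
    fix \<sigma>
    have "(h 1 - 2 * a * h \<sigma>) + (2 * a * h \<sigma>) / 2 \<le> J"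
    proof (rule has_integral_le[OF has_integral_linear_weight hJ])
      show "(h 1 - 2 * a * h \<sigma>) + \<tau> * (2 * a * h \<sigma>) \<le> h \<tau>" if "\<tau> \<in> {0..1}" for \<tau>
        using hd[of 1 \<tau> \<sigma>] that by (simp add: abs_real_def algebra_simps split: if_splits)
    qed
    thus "h 1 - J \<le> a * h \<sigma>" by (simp add: algebra_simps)
  qed
  show "qform (mean_H x y) v \<le> (1 + a) * qform (H x) v"
    and "qform (mean_H x y) v \<le> (1 + a) * qform (H y) v"
    and "qform (H x) v \<le> (1 + a) * qform (mean_H x y) v"
    and "qform (H y) v \<le> (1 + a) * qform (mean_H x y) v"
    using J_le J_le1 le_J le_J1 by (simp_all add: J_def h0 h1 algebra_simps)
qed

end

section \<open>One step of the method\<close>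

context self_concordant
begin

definition step_scale :: "real^'n \<Rightarrow> real^'n \<Rightarrow> real" where
  "step_scale x y = 1 + M * local_norm H x (y - x) / 2"

definition G_bar :: "real^'n^'n \<Rightarrow> real^'n \<Rightarrow> real^'n \<Rightarrow> real^'n^'n" where
  "G_bar G x y = BFGS (mean_H x y) G (y - x)"

definition G_hat :: "real^'n^'n \<Rightarrow> real^'n \<Rightarrow> real^'n \<Rightarrow> real^'n^'n" where
  "G_hat G x y = (step_scale x y)\<^sup>2 *\<^sub>R G_bar G x y"

definition G_next :: "real^'n^'n \<Rightarrow> real^'n \<Rightarrow> real^'n \<Rightarrow> 'n \<Rightarrow> real^'n^'n" where
  "G_next G x y k = BFGS (H y) (G_hat G x y) (axis k 1)"

text \<open>For a quasi-Newton step s one has \<open>g y = J s - G s\<close>, so this is the squared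
  relative error of \<open>G\<close> as a model of \<open>J\<close> along s. Writing it with
  \<open>g y\<close> ties it to the next decrement.\<close>

definition theta2 :: "real^'n^'n \<Rightarrow> real^'n \<Rightarrow> real^'n \<Rightarrow> real" where
  "theta2 G x y = qform (matrix_inv (mean_H x y)) (g y) / qform G (y - x)"

lemma newton_decrement_sq: "(newton_decrement g H x)\<^sup>2 = qform (matrix_inv (H x)) (g x)"
  using posdef_nonneg[OF posdef_matrix_inv[OF posdef_H]]
  by (simp add: newton_decrement_def flip: qform_def)

lemma newton_decrement_nonneg: "0 \<le> newton_decrement g H x"
  using posdef_nonneg[OF posdef_matrix_inv[OF posdef_H]]
  by (simp add: newton_decrement_def flip: qform_def)

lemma L_pos: "0 < L"
  using mu_pos mu_le_L by simp

end

lemma trace_scaleR_mult: "trace ((c *\<^sub>R P) ** A) = c * trace (P ** (A::real^'n^'n))"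
  by (metis trace_mul_sym trace_mult_scaleR)

lemma trace_matrix_inv_antimono:
  fixes A B S :: "real^'n^'n"
  assumes A: "posdef A" and B: "posdef B" and c: "0 < c" and S: "posdef S"
    and le: "\<And>v. qform A v \<le> c * qform B v"
  shows "trace (matrix_inv B ** S) \<le> c * trace (matrix_inv A ** S)"
  using trace_mult_mono_left[OF posdef_sym[OF S] posdef_nonneg[OF S],
      of "matrix_inv B" "c *\<^sub>R matrix_inv A"] matrix_inv_antimono[OF A B c le]
  by (simp add: trace_scaleR_mult)

text \<open>A single transition in isolation, with the two-sided Loewner bound as hypothesis.
  \<open>gx\<close> makes the step nonzero, as the BFGS lemmas demand.\<close>

locale bfgs_step = self_concordant f g H mu L M
  for f :: "real^'n \<Rightarrow> real" and g H mu L M +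
  fixes x y :: "real^'n" and G :: "real^'n^'n" and \<eta> :: real
  assumes G: "posdef G" and H_le_G: "\<And>v. qform (H x) v \<le> qform G v"
    and G_le_H: "\<And>v. qform G v \<le> \<eta> * qform (H x) v" and \<eta>: "1 \<le> \<eta>"
    and step: "y = x - matrix_inv G *v g x" and gx: "g x \<noteq> 0"
begin

abbreviation "\<kappa> \<equiv> step_scale x y"
abbreviation "J \<equiv> mean_H x y"

section \<open>Loewner bounds across one step\<close>

lemma kappa_ge_1: "1 \<le> \<kappa>"
  using M_pos local_norm_nonneg by (simp add: step_scale_def)

lemma kappa_pos: "0 < \<kappa>"
  using kappa_ge_1 by simp

lemma G_step: "G *v (y - x) = - g x"
  using matrix_vector_mult_diff_distrib[of G 0 "matrix_inv G *v g x"]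
  by (simp add: step posdef_matrix_inv_mult[OF G])

lemma step_nonzero: "y - x \<noteq> 0"
  using G_step gx by auto

lemma gradient_step: "g y = J *v (y - x) - G *v (y - x)"
  by (simp add: mean_H_step G_step)

lemma G_step_pos: "0 < qform G (y - x)"
  by (rule posdef_pos[OF G step_nonzero])

text \<open>The left side is the form of \<open>matrix_inv G\<close> at \<open>g x\<close>, and
  inversion reverses the bound of \<open>H x\<close> by \<open>G\<close>.\<close>

lemma G_step_le: "qform G (y - x) \<le> (newton_decrement g H x)\<^sup>2"
proof -
  have "qform G (y - x) = qform (matrix_inv G) (g x)"
    using qform_at_matrix_inv[OF G, of "g x"] qform_scale_arg[of G "-1" "y - x"]
    by (simp add: step)
  also have "\<dots> \<le> qform (matrix_inv (H x)) (g x)"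
    using matrix_inv_antimono[OF posdef_H G, of 1] H_le_G by simp
  finally show ?thesis by (simp add: newton_decrement_sq)
qed

lemma local_norm_step_le: "local_norm H x (y - x) \<le> newton_decrement g H x"
  unfolding local_norm_def
  using H_le_G[of "y - x"] G_step_le
  by (intro real_le_lsqrt newton_decrement_nonneg) auto

lemma J_le_Hx: "qform J v \<le> \<kappa> * qform (H x) v"
  and J_le_Hy: "qform J v \<le> \<kappa> * qform (H y) v"
  and Hx_le_J: "qform (H x) v \<le> \<kappa> * qform J v"
  and Hy_le_J: "qform (H y) v \<le> \<kappa> * qform J v"
  using mean_H_sandwich[where x = x and y = y and v = v] by (simp_all add: step_scale_def)

lemma J_le_G: "qform J v \<le> \<kappa> * qform G v"
  using J_le_Hx[of v] mult_left_mono[OF H_le_G[of v] less_imp_le[OF kappa_pos]] by linarith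

lemma G_le_J: "qform G v \<le> (\<eta> * \<kappa>) * qform J v"
proof -
  have "\<eta> * qform (H x) v \<le> \<eta> * (\<kappa> * qform J v)"
    using Hx_le_J[of v] \<eta> by (intro mult_left_mono) auto
  thus ?thesis using G_le_H[of v] by simp
qed

text \<open>\<open>G\<close> may lie below \<open>J\<close>; the factor \<open>1 / \<kappa>\<close>,
  at most 1, gives the comparison the shape that \<open>BFGS_lower\<close> accepts.\<close>

lemma scaled_J_le_G: "(1 / \<kappa>) * qform J v \<le> qform G v"
  using J_le_G[of v] kappa_pos by (simp add: field_simps)

lemma inverse_kappa: "0 < 1 / \<kappa>" "1 / \<kappa> \<le> 1"
  using kappa_ge_1 by simp_all

lemma eta_kappa_ge_1: "1 \<le> \<eta> * \<kappa>"
  using mult_mono[OF \<eta> kappa_ge_1] \<eta> by simp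

lemma posdef_G_bar: "posdef (G_bar G x y)"
  unfolding G_bar_def
  by (rule posdef_BFGS[OF posdef_mean_H G step_nonzero inverse_kappa scaled_J_le_G])

lemma J_le_G_bar: "qform J v \<le> \<kappa> * qform (G_bar G x y) v"
  using BFGS_lower[OF posdef_mean_H G step_nonzero inverse_kappa scaled_J_le_G, of v] kappa_pos
  by (simp add: G_bar_def field_simps)

lemma G_bar_le_J: "qform (G_bar G x y) v \<le> (\<eta> * \<kappa>) * qform J v"
  unfolding G_bar_def
  by (rule BFGS_upper[OF posdef_mean_H G step_nonzero eta_kappa_ge_1 G_le_J])

lemma posdef_G_hat: "posdef (G_hat G x y)"
  using kappa_pos by (simp add: G_hat_def posdef_scaleR posdef_G_bar)

text \<open>The square of \<open>\<kappa>\<close> in \<open>G_hat\<close> is spent here: one factor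
  passes from \<open>H y\<close> to \<open>J\<close>, the other from \<open>J\<close> to
  \<open>G_bar\<close>.\<close>

lemma Hy_le_G_hat: "qform (H y) v \<le> qform (G_hat G x y) v"
proof -
  have "qform (H y) v \<le> \<kappa> * (\<kappa> * qform (G_bar G x y) v)"
    using Hy_le_J[of v] mult_left_mono[OF J_le_G_bar[of v] less_imp_le[OF kappa_pos]] by linarith
  thus ?thesis by (simp add: G_hat_def power2_eq_square mult.assoc)
qed

text \<open>Of the four factors two are the correction, one comes from \<open>G_bar_le_J\<close> and
  one from replacing \<open>J\<close> by \<open>H y\<close>.\<close>

lemma G_hat_le_Hy: "qform (G_hat G x y) v \<le> (\<eta> * \<kappa> ^ 4) * qform (H y) v"
proof -
  have "qform (G_hat G x y) v \<le> \<kappa>\<^sup>2 * ((\<eta> * \<kappa>) * qform J v)"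
    using G_bar_le_J[of v] by (simp add: G_hat_def mult_left_mono)
  also have "\<dots> \<le> \<kappa>\<^sup>2 * ((\<eta> * \<kappa>) * (\<kappa> * qform (H y) v))"
    using J_le_Hy[of v] eta_kappa_ge_1 by (intro mult_left_mono) auto
  finally show ?thesis by (simp add: power_def numeral_eq_Suc mult_ac)
qed

lemma posdef_G_next: "posdef (G_next G x y k)"
  and Hy_le_G_next: "qform (H y) v \<le> qform (G_next G x y k) v"
  and G_next_le_Hy: "qform (G_next G x y k) v \<le> (\<eta> * \<kappa> ^ 4) * qform (H y) v"
proof -
  have ax: "axis k (1::real) \<noteq> 0" by (simp add: axis_eq_0_iff)
  have lo: "1 * qform (H y) w \<le> qform (G_hat G x y) w" for w using Hy_le_G_hat by simp
  have "1 * 1 \<le> \<eta> * \<kappa> ^ 4" using \<eta> kappa_ge_1 by (intro mult_mono one_le_power) auto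
  thus "qform (G_next G x y k) v \<le> (\<eta> * \<kappa> ^ 4) * qform (H y) v"
    unfolding G_next_def
    by (intro BFGS_upper[OF posdef_H posdef_G_hat ax _ G_hat_le_Hy]) simp
  show "posdef (G_next G x y k)"
    unfolding G_next_def by (rule posdef_BFGS[OF posdef_H posdef_G_hat ax _ _ lo]) auto
  show "qform (H y) v \<le> qform (G_next G x y k) v"
    unfolding G_next_def using BFGS_lower[OF posdef_H posdef_G_hat ax _ _ lo, of v] by simp
qed

section \<open>Decrement and trace after one step\<close>

lemma theta2_nonneg: "0 \<le> theta2 G x y"
  using G_step_pos posdef_nonneg[OF posdef_matrix_inv[OF posdef_mean_H]]
  by (simp add: theta2_def)

lemma newton_decrement_le_theta:
  "(newton_decrement g H y)\<^sup>2 \<le> \<kappa> * theta2 G x y * (newton_decrement g H x)\<^sup>2"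
proof -
  have "(newton_decrement g H y)\<^sup>2 \<le> \<kappa> * qform (matrix_inv J) (g y)"
    unfolding newton_decrement_sq
    by (rule matrix_inv_antimono[OF posdef_mean_H posdef_H kappa_pos J_le_Hy])
  also have "\<dots> = \<kappa> * theta2 G x y * qform G (y - x)"
    using G_step_pos unfolding theta2_def by (metis less_irrefl mult.assoc nonzero_eq_divide_eq)
  also have "\<dots> \<le> \<kappa> * theta2 G x y * (newton_decrement g H x)\<^sup>2"
    using theta2_nonneg kappa_pos by (intro mult_left_mono G_step_le) auto
  finally show ?thesis .
qed

text \<open>Expanding \<open>g y = J s - G s\<close> gives \<open>theta2\<close> as
  \<open>qform J s / qform G s - 2 + q / qform G s\<close>. The last quotient is what the update
  takes from the trace, and the first is at most \<open>\<kappa>\<close>.\<close>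

lemma trace_G_bar: "trace (matrix_inv J ** G_bar G x y)
    \<le> trace (matrix_inv J ** G) - theta2 G x y + (\<kappa> - 1)"
proof -
  define s where "s = y - x"
  define q where "q = qform (matrix_inv J) (G *v s)"
  note Ji = posdef_matrix_inv_mult[OF posdef_mean_H, of x y]
  have qG: "0 < qform G s" using G_step_pos by (simp add: s_def)
  have "qform (matrix_inv J) (g y) = qform (matrix_inv J) (J *v s - 1 *\<^sub>R (G *v s))"
    by (simp add: gradient_step s_def)
  also have "\<dots> = qform J s - 2 * qform G s + q"
    unfolding qform_diff_scaled[OF posdef_matrix_inv_sym[OF posdef_mean_H]]
      qform_matrix_inv_image[OF posdef_mean_H] Ji q_def
    by (simp add: qform_def inner_commute)
  finally have "theta2 G x y = qform J s / qform G s - 2 + q / qform G s"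
    using qG by (simp add: theta2_def s_def[symmetric] add_divide_distrib diff_divide_distrib)
  moreover have "qform J s / qform G s \<le> \<kappa>"
    using J_le_G[of s] qG by (simp add: field_simps)
  moreover have "trace (matrix_inv J ** G_bar G x y) = trace (matrix_inv J ** G) - q / qform G s + 1"
    unfolding G_bar_def q_def s_def by (rule trace_BFGS[OF posdef_mean_H G step_nonzero])
  ultimately show ?thesis by simp
qed

text \<open>The old trace picks up two factors \<open>\<kappa>\<close> from the correction and one
  from each change of the inverted matrix, \<open>H y\<close> to \<open>J\<close> and
  \<open>J\<close> to \<open>H x\<close>.\<close>

lemma trace_G_hat: "trace (matrix_inv (H y) ** G_hat G x y)
    \<le> \<kappa> ^ 4 * trace (matrix_inv (H x) ** G) + \<kappa> ^ 3 * (\<kappa> - 1) - \<kappa> * theta2 G x y"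
proof -
  have 1: "trace (matrix_inv J ** G) \<le> \<kappa> * trace (matrix_inv (H x) ** G)"
    by (rule trace_matrix_inv_antimono[OF posdef_H posdef_mean_H kappa_pos G Hx_le_J])
  have "trace (matrix_inv (H y) ** G_hat G x y) = \<kappa>\<^sup>2 * trace (matrix_inv (H y) ** G_bar G x y)"
    by (simp add: G_hat_def trace_mult_scaleR)
  also have "\<dots> \<le> \<kappa>\<^sup>2 * (\<kappa> * trace (matrix_inv J ** G_bar G x y))"
    by (intro mult_left_mono
        trace_matrix_inv_antimono[OF posdef_mean_H posdef_H kappa_pos posdef_G_bar J_le_Hy]) auto
  also have "\<dots> \<le> \<kappa>\<^sup>2 * (\<kappa> * (\<kappa> * trace (matrix_inv (H x) ** G) - theta2 G x y + (\<kappa> - 1)))"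
    using trace_G_bar 1 kappa_pos by (intro mult_left_mono) auto
  also have "\<dots> = \<kappa> ^ 4 * trace (matrix_inv (H x) ** G) + \<kappa> ^ 3 * (\<kappa> - 1)
      - \<kappa> ^ 3 * theta2 G x y"
    by (simp add: power_def numeral_eq_Suc algebra_simps)
  finally have "trace (matrix_inv (H y) ** G_hat G x y)
    \<le> \<kappa> ^ 4 * trace (matrix_inv (H x) ** G) + \<kappa> ^ 3 * (\<kappa> - 1) - \<kappa> ^ 3 * theta2 G x y" .
  \<comment> \<open>The smaller coefficient makes the decrease equal to the factor in
    \<open>newton_decrement_le_theta\<close>.\<close>
  moreover have "\<kappa> ^ 1 * theta2 G x y \<le> \<kappa> ^ 3 * theta2 G x y"
    using kappa_ge_1 theta2_nonneg by (intro mult_right_mono power_increasing) auto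
  ultimately show ?thesis by simp
qed

text \<open>Nonnegativity of the excess trace is what later allows the contraction factor to be
  enlarged.\<close>

lemma trace_G_hat_ge: "real CARD('n) \<le> trace (matrix_inv (H y) ** G_hat G x y)"
proof -
  have "trace (matrix_inv (H y) ** H y) \<le> trace (matrix_inv (H y) ** G_hat G x y)"
    by (intro trace_mult_mono_right posdef_sym posdef_H posdef_G_hat Hy_le_G_hat
        posdef_nonneg[OF posdef_matrix_inv[OF posdef_H]])
  thus ?thesis by (simp add: posdef_matrix_inv_mult[OF posdef_H] trace_I)
qed

lemma trace_G_next:
  assumes "\<And>j. greedy_ratio (H y) (G_hat G x y) j \<le> greedy_ratio (H y) (G_hat G x y) k"
  shows "trace (matrix_inv (H y) ** G_next G x y k) - CARD('n)
    \<le> (1 - mu / (CARD('n) * L)) * (trace (matrix_inv (H y) ** G_hat G x y) - CARD('n))"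
  unfolding G_next_def
  by (rule greedy_trace_decrease[OF posdef_H posdef_G_hat mu_pos L_pos H_bounds Hy_le_G_hat assms])

text \<open>\<open>matrix_inv G\<close> lies between \<open>1 / (\<eta> * \<kappa>)\<close> and
  \<open>\<kappa>\<close> times \<open>matrix_inv J\<close>, so \<open>m\<close> bounds their
  relative difference. Measuring the gradients with \<open>J\<close> instead of \<open>H x\<close>
  and \<open>H y\<close> costs a square root of \<open>\<kappa>\<close> each.\<close>

lemma newton_decrement_linear_rate:
  assumes m: "0 < m" "\<kappa> - 1 \<le> m" "1 - 1 / (\<eta> * \<kappa>) \<le> m"
  shows "newton_decrement g H y \<le> \<kappa> * m * newton_decrement g H x"
proof -
  have b: "\<bar>qform (matrix_inv J - matrix_inv G) v\<bar> \<le> m * qform (matrix_inv J) v" for v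
  proof -
    have nn: "0 \<le> qform (matrix_inv J) v"
      by (rule posdef_nonneg[OF posdef_matrix_inv[OF posdef_mean_H]])
    have 1: "qform (matrix_inv G) v \<le> \<kappa> * qform (matrix_inv J) v"
      by (rule matrix_inv_antimono[OF posdef_mean_H G kappa_pos J_le_G])
    have "qform (matrix_inv J) v \<le> (\<eta> * \<kappa>) * qform (matrix_inv G) v"
      using eta_kappa_ge_1 by (intro matrix_inv_antimono[OF G posdef_mean_H _ G_le_J]) auto
    hence 2: "(1 / (\<eta> * \<kappa>)) * qform (matrix_inv J) v \<le> qform (matrix_inv G) v"
      using eta_kappa_ge_1 by (simp add: divide_le_eq mult.commute)
    show ?thesis
      using 1 2 mult_right_mono[OF m(2) nn] mult_right_mono[OF m(3) nn]
      by (simp add: abs_le_iff left_diff_distrib)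
  qed
  have gy: "g y = g x - J *v (matrix_inv G *v g x)"
    using mean_H_step[of x y] matrix_vector_mult_diff_distrib[of J 0 "matrix_inv G *v g x"]
    by (simp add: step algebra_simps)
  have J_inv: "qform (matrix_inv J) (g y) \<le> m\<^sup>2 * qform (matrix_inv J) (g x)"
    unfolding gy by (rule inverse_difference_bound[OF posdef_mean_H G m(1) b])
  have Hx_inv: "qform (matrix_inv J) (g x) \<le> \<kappa> * (newton_decrement g H x)\<^sup>2"
    unfolding newton_decrement_sq
    by (rule matrix_inv_antimono[OF posdef_H posdef_mean_H kappa_pos Hx_le_J])
  have Hy_inv: "(newton_decrement g H y)\<^sup>2 \<le> \<kappa> * qform (matrix_inv J) (g y)"
    unfolding newton_decrement_sq
    by (rule matrix_inv_antimono[OF posdef_mean_H posdef_H kappa_pos J_le_Hy])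
  have "(newton_decrement g H y)\<^sup>2 \<le> \<kappa> * (m\<^sup>2 * (\<kappa> * (newton_decrement g H x)\<^sup>2))"
    using kappa_pos
    by (intro order_trans[OF Hy_inv] order_trans[OF J_inv] Hx_inv mult_left_mono) auto
  hence "(newton_decrement g H y)\<^sup>2 \<le> (\<kappa> * m * newton_decrement g H x)\<^sup>2"
    by (simp only: power2_eq_square mult_ac)
  moreover have "0 \<le> \<kappa> * m * newton_decrement g H x"
    using kappa_pos m(1) newton_decrement_nonneg by simp
  ultimately show ?thesis by (rule power2_le_imp_le)
qed

end

section \<open>Convergence\<close>

text \<open>AM--GM, from \<open>y \<le> m exp (y / m - 1)\<close>.\<close>

lemma prod_le_mean_power:
  fixes y :: "nat \<Rightarrow> real"
  assumes y: "\<And>i. i < t \<Longrightarrow> 0 \<le> y i" and m: "0 < m" and sum: "(\<Sum>i<t. y i) \<le> real t * m"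
  shows "(\<Prod>i<t. y i) \<le> m ^ t"
proof -
  have "(\<Prod>i<t. y i) \<le> (\<Prod>i<t. m * exp (y i / m - 1))"
  proof (intro prod_mono conjI)
    fix i assume "i \<in> {..<t}"
    thus "0 \<le> y i" using y by simp
    have "m * (1 + (y i / m - 1)) \<le> m * exp (y i / m - 1)"
      using m by (intro mult_left_mono exp_ge_add_one_self) auto
    thus "y i \<le> m * exp (y i / m - 1)" using m by simp
  qed
  also have "\<dots> = m ^ t * exp ((\<Sum>i<t. y i) / m - real t)"
    by (simp add: prod.distrib sum_subtractf sum_divide_distrib flip: exp_sum)
  also have "\<dots> \<le> m ^ t * 1"
    using sum m by (intro mult_left_mono) (auto simp: divide_le_eq)
  finally show ?thesis by simp
qed

lemma superlinear_rate:
  fixes l \<phi> :: "nat \<Rightarrow> real"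
  assumes q: "0 < q" and l: "\<And>i. 0 \<le> l i" and \<phi>: "\<And>i. i < t \<Longrightarrow> 0 \<le> \<phi> i"
    and step: "\<And>i. i < t \<Longrightarrow> (l (Suc i))\<^sup>2 \<le> \<phi> i * (l i)\<^sup>2"
    and sum: "(\<Sum>i<t. \<phi> i / q ^ i) \<le> S" and S: "0 < S" and t: "1 \<le> t"
  shows "l t \<le> q powr (real t * (real t - 1) / 4) * (S / real t) powr (real t / 2) * l 0"
proof -
  have tele: "k \<le> t \<Longrightarrow> (l k)\<^sup>2 \<le> (\<Prod>i<k. \<phi> i) * (l 0)\<^sup>2" for k
  proof (induction k)
    case (Suc k)
    have "(l (Suc k))\<^sup>2 \<le> \<phi> k * (l k)\<^sup>2" using step Suc.prems by simp
    also have "\<dots> \<le> \<phi> k * ((\<Prod>i<k. \<phi> i) * (l 0)\<^sup>2)"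
      using Suc \<phi> by (intro mult_left_mono) auto
    finally show ?case by (simp add: mult_ac)
  qed simp
  have gauss: "real (\<Sum>i<t. i) = real t * (real t - 1) / 2"
    using t by (induction t rule: dec_induct) (auto simp: field_simps)
  \<comment> \<open>Splitting off the weights leaves factors with a bounded sum, ready for AM--GM
    with mean \<open>S / t\<close>.\<close>
  have "(\<Prod>i<t. \<phi> i) = (\<Prod>i<t. q ^ i) * (\<Prod>i<t. \<phi> i / q ^ i)"
    using q by (simp flip: prod.distrib)
  also have "\<dots> \<le> (\<Prod>i<t. q ^ i) * (S / real t) ^ t"
    using q \<phi> S t sum by (intro mult_left_mono prod_le_mean_power prod_nonneg) auto
  also have "(\<Prod>i<t. q ^ i) = q powr (real t * (real t - 1) / 2)"
    unfolding gauss[symmetric] powr_realpow[OF q] by (simp add: power_sum)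
  also have "(S / real t) ^ t = (S / real t) powr real t"
    using S t by (simp add: powr_realpow)
  finally have prod: "(\<Prod>i<t. \<phi> i) \<le> q powr (real t * (real t - 1) / 2) * (S / real t) powr real t" .
  have "(l t)\<^sup>2 \<le> (q powr (real t * (real t - 1) / 2) * (S / real t) powr real t) * (l 0)\<^sup>2"
    using tele[of t] mult_right_mono[OF prod, of "(l 0)\<^sup>2"] by simp
  \<comment> \<open>Taking the square root halves both exponents.\<close>
  also have "\<dots> = (q powr (real t * (real t - 1) / 4) * (S / real t) powr (real t / 2) * l 0)\<^sup>2"
    unfolding power_mult_distrib by (simp add: power2_eq_square flip: powr_add)
  finally show ?thesis
    by (rule power2_le_imp_le) (simp add: l)
qed

lemma geometric_decay:
  fixes l :: "nat \<Rightarrow> real"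
  assumes r: "0 \<le> r" "r < 1" and step: "\<And>i. i < k \<Longrightarrow> l (Suc i) \<le> r * l i"
  shows "i \<le> k \<Longrightarrow> l i \<le> r ^ i * l 0"
proof (induction i)
  case (Suc i)
  have "l (Suc i) \<le> r * l i" using step Suc.prems by simp
  also have "\<dots> \<le> r * (r ^ i * l 0)" using Suc r by (intro mult_left_mono) auto
  finally show ?case by simp
qed simp

lemma geometric_sum_le:
  fixes r :: real
  assumes "0 \<le> r" "r < 1"
  shows "(\<Sum>i<k. r ^ i) \<le> 1 / (1 - r)"
  using assms sum_gp_strict[of r k] by (simp add: divide_right_mono)

text \<open>\<open>B\<close> is the quantity between the two updates. Being nonnegative, it lets
  \<open>c\<close> be raised to \<open>q\<close>; division by \<open>q ^ Suc k\<close> then makes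
  the inequality telescope.\<close>

lemma weighted_telescope:
  fixes \<sigma> B E \<phi> :: "nat \<Rightarrow> real"
  assumes q: "0 < q" and \<rho>: "c \<le> q"
    and B: "\<And>i. i < t \<Longrightarrow> 0 \<le> B i" "\<And>i. i < t \<Longrightarrow> B i \<le> \<sigma> i + E i - \<phi> i"
    and \<sigma>: "\<And>i. i < t \<Longrightarrow> \<sigma> (Suc i) \<le> c * B i"
  shows "k \<le> t \<Longrightarrow> (\<Sum>i<k. \<phi> i / q ^ i) + \<sigma> k / q ^ k \<le> \<sigma> 0 + (\<Sum>i<k. E i / q ^ i)"
proof (induction k)
  case (Suc k)
  hence k: "k < t" by simp
  have "\<sigma> (Suc k) \<le> q * (\<sigma> k + E k - \<phi> k)"
  proof -
    have "\<sigma> (Suc k) \<le> c * B k" by (rule \<sigma>[OF k])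
    also have "\<dots> \<le> q * B k" using \<rho> B(1)[OF k] by (rule mult_right_mono)
    also have "\<dots> \<le> q * (\<sigma> k + E k - \<phi> k)" using B(2)[OF k] q by simp
    finally show ?thesis .
  qed
  hence "\<sigma> (Suc k) / q ^ Suc k \<le> (q * (\<sigma> k + E k - \<phi> k)) / q ^ Suc k"
    using q by (intro divide_right_mono) auto
  also have "\<dots> = \<sigma> k / q ^ k + E k / q ^ k - \<phi> k / q ^ k"
    using q by (simp add: add_divide_distrib diff_divide_distrib)
  finally show ?case using Suc by simp
qed simp

locale sharpened_bfgs = self_concordant f g H mu L M
  for f :: "real^'n \<Rightarrow> real" and g H mu L M +
  fixes x :: "nat \<Rightarrow> real^'n" and G :: "nat \<Rightarrow> real^'n^'n" and ubar :: "nat \<Rightarrow> 'n" and t :: nat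
  assumes G0: "G 0 = L *\<^sub>R mat 1"
    and step: "\<And>k. x (Suc k) = x k - matrix_inv (G k) *v g (x k)"
    and ubar: "\<And>k j. greedy_ratio (H (x (Suc k))) (G_hat (G k) (x k) (x (Suc k))) j
      \<le> greedy_ratio (H (x (Suc k))) (G_hat (G k) (x k) (x (Suc k))) (ubar k)"
    and G_upd: "\<And>k. G (Suc k) = G_next (G k) (x k) (x (Suc k)) (ubar k)"
    and init: "newton_decrement g H (x 0) \<le> (ln 2 / 20) * mu / (real CARD('n) * M * L)"
    and nonzero: "\<And>k. k \<le> t \<Longrightarrow> g (x k) \<noteq> 0"
begin

section \<open>Uniform control of the iterates by induction\<close>

definition X :: real where "X = mu / L"
definition d :: real where "d = real CARD('n)"
definition l :: "nat \<Rightarrow> real" where "l k = newton_decrement g H (x k)"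
text \<open>The start value \<open>1 / X\<close> reflects that \<open>L I\<close> is at most
  \<open>L / mu\<close> times the Hessian. Each fourth power of the correction factor is at most
  \<open>exp (2 * M * l i)\<close>, so the product becomes a sum in the exponent.\<close>

definition \<eta> :: "nat \<Rightarrow> real" where "\<eta> k = exp (2 * (\<Sum>i<k. M * l i)) / X"

lemma X: "0 < X" "X \<le> 1"
  using mu_pos L_pos mu_le_L by (auto simp: X_def)

lemma d_ge_1: "1 \<le> d"
  by (simp add: d_def Suc_le_eq)

lemma l_nonneg: "0 \<le> l k"
  by (simp add: l_def newton_decrement_nonneg)

lemma Ml0: "M * l 0 \<le> X / (20 * d)"
proof -
  have "l 0 \<le> (ln 2 / 20) * mu / (d * M * L)" using init by (simp add: l_def d_def)
  hence "M * l 0 \<le> M * ((ln 2 / 20) * mu / (d * M * L))"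
    using M_pos by (intro mult_left_mono) auto
  also have "\<dots> = ln 2 * (X / (20 * d))"
    using M_pos by (simp add: X_def)
  also have "\<dots> \<le> 1 * (X / (20 * d))"
    using ln_2_less_1 X d_ge_1 by (intro mult_right_mono) auto
  finally show ?thesis by simp
qed

lemma Ml0_le: "M * l 0 \<le> X / 20"
proof -
  have "X / (20 * d) \<le> X / 20" using X d_ge_1 by (intro divide_left_mono) auto
  thus ?thesis using Ml0 by simp
qed

lemma l_decay:
  assumes "\<And>i. i < k \<Longrightarrow> l (Suc i) \<le> (1 - 3 / 4 * X) * l i" "i \<le> k"
  shows "M * l i \<le> (1 - 3 / 4 * X) ^ i * (M * l 0)"
proof -
  have "l i \<le> (1 - 3 / 4 * X) ^ i * l 0"
    using X assms by (intro geometric_decay[of _ k]) auto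
  thus ?thesis using mult_left_mono[of _ _ M] M_pos by (simp add: mult.left_commute)
qed

lemma \<eta>_bounds:
  assumes "\<And>i. i < k \<Longrightarrow> l (Suc i) \<le> (1 - 3 / 4 * X) * l i"
  shows "1 \<le> \<eta> k" "\<eta> k \<le> 15 / 13 / X"
proof -
  have nn: "0 \<le> (\<Sum>i<k. M * l i)" using M_pos l_nonneg by (intro sum_nonneg) auto
  hence "1 \<le> exp (2 * (\<Sum>i<k. M * l i))" by simp
  hence "X \<le> exp (2 * (\<Sum>i<k. M * l i))" using X by linarith
  thus "1 \<le> \<eta> k" using X by (simp add: \<eta>_def)
  have "(\<Sum>i<k. M * l i) \<le> (\<Sum>i<k. (1 - 3 / 4 * X) ^ i * (M * l 0))"
    by (intro sum_mono l_decay[OF assms]) auto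
  also have "\<dots> = (\<Sum>i<k. (1 - 3 / 4 * X) ^ i) * (M * l 0)" by (simp add: sum_distrib_right)
  \<comment> \<open>The geometric series costs \<open>4 / (3 * X)\<close>, and the factor
    \<open>X\<close> in the initial bound cancels it.\<close>
  also have "\<dots> \<le> (1 / (1 - (1 - 3 / 4 * X))) * (X / 20)"
    using X M_pos l_nonneg by (intro mult_mono geometric_sum_le Ml0_le) auto
  also have "\<dots> = 1 / 15" using X by simp
  finally have "2 * (\<Sum>i<k. M * l i) \<le> 2 / 15" by simp
  hence "exp (2 * (\<Sum>i<k. M * l i)) \<le> exp (2 / 15)" by simp
  \<comment> \<open>Inverts \<open>exp (- 2 / 15) >= 13 / 15\<close>.\<close>
  also have "\<dots> \<le> (15 / 13 :: real)"
    using exp_ge_add_one_self[of "- (2 / 15) :: real"] by (simp add: exp_minus field_simps)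
  finally show "\<eta> k \<le> 15 / 13 / X" unfolding \<eta>_def by (rule divide_right_mono) (use X in simp)
qed

text \<open>The decay of all earlier steps is carried along because it bounds
  \<open>\<eta> k\<close>, which in turn yields the decay of the next step.\<close>

definition invariant :: "nat \<Rightarrow> bool" where
  "invariant k \<longleftrightarrow> posdef (G k) \<and> (\<forall>v. qform (H (x k)) v \<le> qform (G k) v)
    \<and> (\<forall>v. qform (G k) v \<le> \<eta> k * qform (H (x k)) v)
    \<and> (\<forall>i<k. l (Suc i) \<le> (1 - 3 / 4 * X) * l i)"

lemma bfgs_step:
  assumes "invariant k" "k \<le> t"
  shows "bfgs_step f g H mu L M (x k) (x (Suc k)) (G k) (\<eta> k)"
  using assms nonzero[of k] \<eta>_bounds(1)[of k] step[of k]
  by unfold_locales (auto simp: invariant_def)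

lemma step_scale_bounds:
  assumes "invariant k" "k \<le> t"
  shows "1 \<le> step_scale (x k) (x (Suc k))"
    "step_scale (x k) (x (Suc k)) - 1 \<le> M * l k / 2"
    "M * l k \<le> X / 20"
proof -
  interpret bfgs_step f g H mu L M "x k" "x (Suc k)" "G k" "\<eta> k" by (rule bfgs_step[OF assms])
  show "1 \<le> step_scale (x k) (x (Suc k))" by (rule kappa_ge_1)
  show "step_scale (x k) (x (Suc k)) - 1 \<le> M * l k / 2"
    using local_norm_step_le M_pos by (simp add: step_scale_def l_def mult_left_mono)
  have "M * l k \<le> (1 - 3 / 4 * X) ^ k * (M * l 0)"
    using assms by (intro l_decay[of k]) (auto simp: invariant_def)
  also have "\<dots> \<le> 1 * (M * l 0)"
    using X M_pos l_nonneg[of 0] by (intro mult_right_mono power_le_one) auto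
  finally show "M * l k \<le> X / 20" using Ml0_le by simp
qed

lemma invariant_0: "invariant 0"
proof -
  have "L * (v \<bullet> v) \<le> (1 / X) * qform (H (x 0)) v" for v
    using H_bounds(1)[of v "x 0"] mu_pos L_pos by (simp add: X_def field_simps)
  moreover have "posdef (L *\<^sub>R mat 1 :: real^'n^'n)"
    by (rule posdef_scaleR[OF posdef_mat_1 L_pos])
  ultimately show ?thesis
    using H_bounds(2) by (simp add: invariant_def G0 \<eta>_def)
qed

lemma invariant_Suc:
  assumes inv: "invariant k" and k: "k < t"
  shows "invariant (Suc k)"
proof -
  interpret bfgs_step f g H mu L M "x k" "x (Suc k)" "G k" "\<eta> k"
    using inv k by (intro bfgs_step) auto
  let ?\<kappa> = "step_scale (x k) (x (Suc k))"
  define a where "a = ?\<kappa> - 1"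
  have decay: "\<And>i. i < k \<Longrightarrow> l (Suc i) \<le> (1 - 3 / 4 * X) * l i"
    using inv by (simp add: invariant_def)
  note b = step_scale_bounds[OF inv less_imp_le[OF k]]
  have a: "0 \<le> a" "a \<le> M * l k / 2" "a \<le> X / 40" "?\<kappa> = 1 + a" using b by (auto simp: a_def)
  have "(1 + a) ^ 4 \<le> exp a ^ 4"
    using a(1) exp_ge_add_one_self[of a] by (intro power_mono) auto
  also have "\<dots> = exp (4 * a)" by (simp flip: exp_of_nat_mult)
  also have "\<dots> \<le> exp (2 * (M * l k))" using a(2) by simp
  finally have "\<eta> k * ?\<kappa> ^ 4 \<le> \<eta> k * exp (2 * (M * l k))"
    using \<eta> a(4) by (intro mult_left_mono) auto
  also have "\<dots> = \<eta> (Suc k)" by (simp add: \<eta>_def distrib_left exp_add)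
  finally have \<eta>_Suc: "\<eta> k * ?\<kappa> ^ 4 \<le> \<eta> (Suc k)" .
  have up: "qform (G (Suc k)) v \<le> \<eta> (Suc k) * qform (H (x (Suc k))) v" for v
    using G_next_le_Hy[of "ubar k" v] mult_right_mono[OF \<eta>_Suc posdef_nonneg[OF posdef_H]]
    unfolding G_upd by (rule order_trans)
  \<comment> \<open>This \<open>m\<close> makes the rate \<open>\<kappa> * m\<close> of
    \<open>newton_decrement_linear_rate\<close> exactly \<open>1 - 3 / 4 * X\<close>; its two lower
    bounds remain to be checked.\<close>
  define m where "m = (1 - 3 / 4 * X) / ?\<kappa>"
  have m0: "0 < m" using X a by (simp add: m_def)
  have \<kappa>m: "?\<kappa> * m = 1 - 3 / 4 * X" using a by (simp add: m_def)
  have "a * (1 + a) \<le> (1 / 40) * (1 + 1 / 40)"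
    using a X by (intro mult_mono) auto
  hence "(?\<kappa> - 1) * ?\<kappa> \<le> 1 - 3 / 4 * X" using X a(4) by simp
  hence m1: "?\<kappa> - 1 \<le> m" using a by (simp add: m_def pos_le_divide_eq)
  have "13 / 15 * X \<le> 1 / \<eta> k"
    using \<eta>_bounds(2)[OF decay] \<eta> X by (simp add: field_simps)
  \<comment> \<open>As \<open>?\<kappa> <= 1 + X / 40\<close>, this rests on
    \<open>13 / 15 - 1 / 40 >= 3 / 4\<close>.\<close>
  hence "?\<kappa> - 1 / \<eta> k \<le> 1 - 3 / 4 * X" using a by simp
  hence "(1 - 1 / (\<eta> k * ?\<kappa>)) * ?\<kappa> \<le> 1 - 3 / 4 * X"
    using a by (simp add: left_diff_distrib)
  hence m2: "1 - 1 / (\<eta> k * ?\<kappa>) \<le> m" using a by (simp add: m_def pos_le_divide_eq)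
  have rate: "l (Suc k) \<le> (1 - 3 / 4 * X) * l k"
    using newton_decrement_linear_rate[OF m0 m1 m2] unfolding \<kappa>m l_def .
  show ?thesis
    unfolding invariant_def
    using up rate decay Hy_le_G_next posdef_G_next
    by (auto simp: G_upd less_Suc_eq)
qed

lemma invariant: "k \<le> t \<Longrightarrow> invariant k"
  by (induction k) (auto intro: invariant_0 invariant_Suc)

section \<open>The trace recursion and its weighted sum\<close>

definition \<sigma> :: "nat \<Rightarrow> real" where
  "\<sigma> k = trace (matrix_inv (H (x k)) ** G k) - d"

definition \<phi> :: "nat \<Rightarrow> real" where
  "\<phi> k = step_scale (x k) (x (Suc k)) * theta2 (G k) (x k) (x (Suc k))"

lemma trace_le:
  assumes "\<And>v. qform (G k) v \<le> c * qform (H (x k)) v" "posdef (G k)"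
  shows "trace (matrix_inv (H (x k)) ** G k) \<le> c * d"
proof -
  have "trace (matrix_inv (H (x k)) ** G k) \<le> trace (matrix_inv (H (x k)) ** (c *\<^sub>R H (x k)))"
    using assms
    by (intro trace_mult_mono_right posdef_nonneg[OF posdef_matrix_inv[OF posdef_H]])
      (auto simp: posdef_sym transpose_scalar H_sym)
  thus ?thesis by (simp add: trace_mult_scaleR posdef_matrix_inv_mult[OF posdef_H] trace_I d_def)
qed

lemma \<sigma>_nonneg:
  assumes "k \<le> t" shows "0 \<le> \<sigma> k"
proof -
  have inv: "posdef (G k)" "\<And>v. qform (H (x k)) v \<le> qform (G k) v"
    using invariant[OF assms] by (auto simp: invariant_def)
  have "trace (matrix_inv (H (x k)) ** H (x k)) \<le> trace (matrix_inv (H (x k)) ** G k)"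
    using inv by (intro trace_mult_mono_right posdef_nonneg[OF posdef_matrix_inv[OF posdef_H]])
      (auto simp: posdef_sym H_sym)
  thus ?thesis by (simp add: \<sigma>_def posdef_matrix_inv_mult[OF posdef_H] trace_I d_def)
qed

text \<open>The excess trace after the correction and before the greedy update; it serves as
  \<open>B\<close> in \<open>weighted_telescope\<close>.\<close>

definition \<sigma>_hat :: "nat \<Rightarrow> real" where
  "\<sigma>_hat k = trace (matrix_inv (H (x (Suc k))) ** G_hat (G k) (x k) (x (Suc k))) - d"

lemma trace_recursion:
  assumes k: "k < t"
  shows "0 \<le> \<sigma>_hat k" "\<sigma>_hat k \<le> \<sigma> k + 4 * (M * l k) * (d / X) - \<phi> k"
    "\<sigma> (Suc k) \<le> (1 - X / d) * \<sigma>_hat k"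
proof -
  have inv: "invariant k" using k invariant by simp
  interpret bfgs_step f g H mu L M "x k" "x (Suc k)" "G k" "\<eta> k"
    using inv k by (intro bfgs_step) auto
  let ?\<kappa> = "step_scale (x k) (x (Suc k))"
  define a where "a = ?\<kappa> - 1"
  define T where "T = trace (matrix_inv (H (x k)) ** G k)"
  note b = step_scale_bounds[OF inv less_imp_le[OF k]]
  have a: "0 \<le> a" "a \<le> M * l k / 2" "a \<le> 1 / 40" "?\<kappa> = 1 + a" using b X by (auto simp: a_def)
  show "0 \<le> \<sigma>_hat k" using trace_G_hat_ge by (simp add: \<sigma>_hat_def d_def)
  have "T \<le> \<eta> k * d"
    unfolding T_def using inv by (intro trace_le) (auto simp: invariant_def)
  also have "\<dots> \<le> (15 / 13 / X) * d"
    using d_ge_1 inv by (intro mult_right_mono \<eta>_bounds(2)) (auto simp: invariant_def)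
  finally have T: "T \<le> 15 / 13 * (d / X)" by simp
  have dX: "1 \<le> d / X" using d_ge_1 X by simp
  \<comment> \<open>With \<open>a <= 1 / 40\<close> the higher powers become small multiples of
    \<open>a\<close>, leaving the bounds \<open>5 * a\<close> and \<open>2 * a\<close>
    below.\<close>
  have a2: "a * a \<le> a * (1 / 40)" using a by (intro mult_left_mono) auto
  have a3: "a * a * a \<le> a * (1 / 40) * (1 / 40)" using a a2 by (intro mult_mono) auto
  have a4: "a * a * a * a \<le> a * (1 / 40) * (1 / 40) * (1 / 40)" using a a3 by (intro mult_mono) auto
  have "(1 + a) ^ 4 - 1 = 4 * a + 6 * (a * a) + 4 * (a * a * a) + a * a * a * a"
    by (simp add: numeral_eq_Suc algebra_simps)
  hence k4: "(1 + a) ^ 4 - 1 \<le> 5 * a" using a2 a3 a4 a(1) by simp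
  have k4': "0 \<le> (1 + a) ^ 4 - 1" using a(1) by simp
  have "(1 + a) ^ 3 * a = a + 3 * (a * a) + 3 * (a * a * a) + a * a * a * a"
    by (simp add: numeral_eq_Suc algebra_simps)
  hence k3: "(1 + a) ^ 3 * a \<le> 2 * a" using a2 a3 a4 a(1) by simp
  have "((1 + a) ^ 4 - 1) * T \<le> ((1 + a) ^ 4 - 1) * (15 / 13 * (d / X))"
    using T k4' by (rule mult_left_mono)
  also have "\<dots> \<le> (5 * a) * (15 / 13 * (d / X))"
    using k4 dX by (intro mult_right_mono) auto
  finally have "((1 + a) ^ 4 - 1) * T + (1 + a) ^ 3 * a
      \<le> (75 / 13 * a) * (d / X) + (2 * a) * (d / X)"
    using k3 mult_left_mono[OF dX, of "2 * a"] a(1) by simp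
  also have "\<dots> = (101 / 13 * a) * (d / X)" by (simp add: algebra_simps)
  \<comment> \<open>From \<open>a <= M * l k / 2\<close> the coefficient is \<open>101 / 26\<close>,
    below 4.\<close>
  also have "\<dots> \<le> (4 * (M * l k)) * (d / X)"
    using a dX by (intro mult_right_mono) auto
  finally have "(1 + a) ^ 4 * T + (1 + a) ^ 3 * a \<le> T + 4 * (M * l k) * (d / X)"
    by (simp add: left_diff_distrib)
  thus "\<sigma>_hat k \<le> \<sigma> k + 4 * (M * l k) * (d / X) - \<phi> k"
    using trace_G_hat by (simp add: \<sigma>_hat_def \<sigma>_def \<phi>_def T_def a(4))
  show "\<sigma> (Suc k) \<le> (1 - X / d) * \<sigma>_hat k"
    using trace_G_next[OF ubar]
    by (simp add: \<sigma>_def G_upd \<sigma>_hat_def d_def X_def mult.commute)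
qed

lemma weighted_sum_\<phi>: "(\<Sum>i<t. \<phi> i / (1 - X / (2 * d)) ^ i) \<le> 8 * d / X"
proof -
  define q where "q = 1 - X / (2 * d)"
  have Xd: "X / (2 * d) \<le> X / 2" using X d_ge_1 by (intro divide_left_mono) auto
  have q: "0 < q" "1 - X / 2 \<le> q" using Xd X by (auto simp: q_def)
  have dX: "1 \<le> d / X" using d_ge_1 X by simp
  have "X / (2 * d) \<le> X / d" using X d_ge_1 by (intro divide_left_mono) auto
  hence c: "1 - X / d \<le> q" by (simp add: q_def)
  have decay: "\<And>i. i < t \<Longrightarrow> l (Suc i) \<le> (1 - 3 / 4 * X) * l i"
    using invariant[of t] by (simp add: invariant_def)
  \<comment> \<open>The decay rate \<open>1 - 3 / 4 * X\<close> is at most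
    \<open>(1 - X / 4) * q\<close>, so division by \<open>q ^ i\<close> still leaves the summable
    ratio \<open>1 - X / 4\<close>. The prefactor is \<open>4 / 20\<close>.\<close>
  have error: "4 * (M * l i) * (d / X) / q ^ i \<le> 1 / 5 * (1 - X / 4) ^ i" if "i < t" for i
  proof -
    have "1 - 3 / 4 * X \<le> (1 - X / 4) * (1 - X / 2)"
      by (simp add: algebra_simps)
    also have "\<dots> \<le> (1 - X / 4) * q" using X q by (intro mult_left_mono) auto
    finally have "(1 - 3 / 4 * X) / q \<le> 1 - X / 4" using q by (simp add: divide_le_eq)
    hence pw: "((1 - 3 / 4 * X) / q) ^ i \<le> (1 - X / 4) ^ i"
      using X q by (intro power_mono) auto
    have "M * l i \<le> (1 - 3 / 4 * X) ^ i * (M * l 0)"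
      using that by (intro l_decay[OF decay]) auto
    also have "\<dots> \<le> (1 - 3 / 4 * X) ^ i * (X / (20 * d))"
      using X by (intro mult_left_mono Ml0) auto
    finally have "M * l i / q ^ i \<le> (1 - 3 / 4 * X) ^ i * (X / (20 * d)) / q ^ i"
      using q by (intro divide_right_mono) auto
    also have "\<dots> = ((1 - 3 / 4 * X) / q) ^ i * (X / (20 * d))"
      by (simp add: power_divide)
    also have "\<dots> \<le> (1 - X / 4) ^ i * (X / (20 * d))"
      using pw X d_ge_1 by (intro mult_right_mono) auto
    finally have "(M * l i / q ^ i) * (4 * (d / X)) \<le> ((1 - X / 4) ^ i * (X / (20 * d))) * (4 * (d / X))"
      using dX by (intro mult_right_mono) auto
    also have "\<dots> = 1 / 5 * (1 - X / 4) ^ i" using X d_ge_1 by simp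
    finally show ?thesis by (simp add: mult_ac)
  qed
  have "(\<Sum>i<t. 4 * (M * l i) * (d / X) / q ^ i) \<le> (\<Sum>i<t. 1 / 5 * (1 - X / 4) ^ i)"
    by (intro sum_mono error) simp
  also have "\<dots> = 1 / 5 * (\<Sum>i<t. (1 - X / 4) ^ i)"
    by (simp add: sum_distrib_left)
  also have "\<dots> \<le> 1 / 5 * (1 / (1 - (1 - X / 4)))"
    using X by (intro mult_left_mono geometric_sum_le) auto
  also have "\<dots> = 4 / 5 / X" by simp
  also have "\<dots> \<le> d / X" using X d_ge_1 by (intro divide_right_mono) auto
  finally have E: "(\<Sum>i<t. 4 * (M * l i) * (d / X) / q ^ i) \<le> d / X" .
  have "trace (matrix_inv (H (x 0)) ** G 0) \<le> (1 / X) * d"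
    using invariant_0 by (intro trace_le) (auto simp: invariant_def \<eta>_def)
  hence \<sigma>0: "\<sigma> 0 \<le> d / X" using d_ge_1 by (simp add: \<sigma>_def)
  \<comment> \<open>The initial trace and the accumulated errors each contribute at most
    \<open>d / X\<close>.\<close>
  have "(\<Sum>i<t. \<phi> i / q ^ i) + \<sigma> t / q ^ t \<le> \<sigma> 0 + (\<Sum>i<t. 4 * (M * l i) * (d / X) / q ^ i)"
    by (rule weighted_telescope[where B = \<sigma>_hat, OF q(1) c trace_recursion]) auto
  moreover have "0 \<le> \<sigma> t / q ^ t" using q \<sigma>_nonneg[of t] by simp
  ultimately have "(\<Sum>i<t. \<phi> i / q ^ i) \<le> 2 * (d / X)" using E \<sigma>0 by linarith
  also have "\<dots> \<le> 8 * d / X" using dX by simp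
  finally show ?thesis by (simp add: q_def)
qed

lemma newton_decrement_superlinear:
  assumes t: "1 \<le> t"
  shows "l t \<le> (1 - X / (2 * d)) powr (real t * (real t - 1) / 4)
    * ((8 * d / X) / real t) powr (real t / 2) * l 0"
proof (rule superlinear_rate[OF _ l_nonneg _ _ weighted_sum_\<phi> _ t])
  have "X / (2 * d) \<le> X / 2" using X d_ge_1 by (intro divide_left_mono) auto
  thus "0 < 1 - X / (2 * d)" using X by simp
  show "0 < 8 * d / X" using X d_ge_1 by simp
  fix i assume i: "i < t"
  interpret bfgs_step f g H mu L M "x i" "x (Suc i)" "G i" "\<eta> i"
    using i by (intro bfgs_step invariant) auto
  show "0 \<le> \<phi> i" using theta2_nonneg kappa_ge_1 by (simp add: \<phi>_def)
  show "(l (Suc i))\<^sup>2 \<le> \<phi> i * (l i)\<^sup>2" using newton_decrement_le_theta by (simp add: \<phi>_def l_def)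
qed

end

theorem theorem4:
  fixes f :: "real^'n \<Rightarrow> real"
    and g :: "real^'n \<Rightarrow> real^'n"
    and H :: "real^'n \<Rightarrow> real^'n^'n"
    and mu L M :: real
    and x :: "nat \<Rightarrow> real^'n"
    and G :: "nat \<Rightarrow> real^'n^'n"
    and ubar :: "nat \<Rightarrow> 'n"
  assumes grad: "\<And>y. (f has_derivative (\<lambda>h. g y \<bullet> h)) (at y)"
    and hess: "\<And>y. (g has_derivative (\<lambda>h. H y *v h)) (at y)"
    and mu_pos: "0 < mu" and mu_le_L: "mu \<le> L" and M_pos: "0 < M"
    and sconv: "strongly_convex_on UNIV mu f"
    and lip: "L-lipschitz_on UNIV g"
    and ssc: "strongly_self_concordant M H"
    and G0: "G 0 = L *\<^sub>R mat 1"
    and step: "\<And>t. x (Suc t) = x t - matrix_inv (G t) *v g (x t)"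
    and ubar_max: "\<And>t j.
          greedy_ratio (H (x (Suc t)))
            (((1 + M * local_norm H (x t) (x (Suc t) - x t) / 2)\<^sup>2) *\<^sub>R
               BFGS (integral {0..1} (\<lambda>\<tau>. H (x t + \<tau> *\<^sub>R (x (Suc t) - x t))))
                    (G t) (x (Suc t) - x t)) j
          \<le> greedy_ratio (H (x (Suc t)))
            (((1 + M * local_norm H (x t) (x (Suc t) - x t) / 2)\<^sup>2) *\<^sub>R
               BFGS (integral {0..1} (\<lambda>\<tau>. H (x t + \<tau> *\<^sub>R (x (Suc t) - x t))))
                    (G t) (x (Suc t) - x t)) (ubar t)"
    and G_upd: "\<And>t. G (Suc t) =
          BFGS (H (x (Suc t)))
            (((1 + M * local_norm H (x t) (x (Suc t) - x t) / 2)\<^sup>2) *\<^sub>R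
               BFGS (integral {0..1} (\<lambda>\<tau>. H (x t + \<tau> *\<^sub>R (x (Suc t) - x t))))
                    (G t) (x (Suc t) - x t))
            (axis (ubar t) 1)"
    and init: "newton_decrement g H (x 0) \<le> (ln 2 / 20) * mu / (real CARD('n) * M * L)"
    and t_ge: "1 \<le> t"
    and nonzero: "\<And>k. k \<le> t \<Longrightarrow> g (x k) \<noteq> 0"
  shows "newton_decrement g H (x t) \<le>
           2 * (1 - mu / (2 * real CARD('n) * L)) powr (real t * (real t - 1) / 4)
             * (8 * real CARD('n) * L / (real t * mu)) powr (real t / 2)
             * newton_decrement g H (x 0)"
proof -
  interpret self_concordant f g H mu L M
    by unfold_locales (fact grad hess mu_pos mu_le_L M_pos sconv lip ssc)+
  have hat: "((1 + M * local_norm H (x t) (x (Suc t) - x t) / 2)\<^sup>2) *\<^sub>R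
      BFGS (integral {0..1} (\<lambda>\<tau>. H (x t + \<tau> *\<^sub>R (x (Suc t) - x t)))) (G t) (x (Suc t) - x t)
      = G_hat (G t) (x t) (x (Suc t))" for t
    by (simp add: G_hat_def G_bar_def step_scale_def mean_H_def)
  interpret sharpened_bfgs f g H mu L M x G ubar t
    by unfold_locales
      (fact G0 step ubar_max[unfolded hat] G_upd[unfolded hat, folded G_next_def] init nonzero)+
  define b where "b = (1 - X / (2 * d)) powr (real t * (real t - 1) / 4)
    * ((8 * d / X) / real t) powr (real t / 2) * l 0"
  have e: "X / (2 * d) = mu / (2 * real CARD('n) * L)"
    "(8 * d / X) / real t = 8 * real CARD('n) * L / (real t * mu)"
    by (simp_all add: X_def d_def)
  \<comment> \<open>Nonnegativity gives \<open>b <= 2 * b\<close>, which brings in the factor 2 of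
    the claim.\<close>
  have "0 \<le> b" using l_nonneg by (simp add: b_def)
  moreover have "l t \<le> b" unfolding b_def by (rule newton_decrement_superlinear[OF t_ge])
  ultimately have "l t \<le> 2 * b" by simp
  thus ?thesis by (simp only: b_def e l_def mult.assoc)
qed

end
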